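(* Let $\alpha>0$. The Hilbert space $\mathcal{T}_2^{(\alpha)}(t^\alpha)$ is a reproducing kernel Hilbert space (RKHS) if and only if $\alpha>1/2$. In this case, the reproducing kernel of $\mathcal{T}_2^{(\alpha)}(t^\alpha)$ is the function $$k_\alpha(s,t)=\int_0^\infty g_\alpha(s,r)\,g_\alpha(t,r)\,dr,\qquad s,t>0,$$ where $$g_\alpha(t,r)=\frac{(r-t)_+^{\alpha-1}}{r^\alpha\,\Gamma(\alpha)},\qquad t,r>0.$$
   Context: $\mathbb{R}^+=(0,\infty)$; $(x)_+^{\alpha-1}=x^{\alpha-1}$ if $x>0$ and $0$ otherwise. $L_2(\mathbb{R}^+,t^{2\alpha})$ is the space of measurable $g$ with $t\mapsto t^\alpha g(t)$ in $L_2(\mathbb{R}^+)$. For $\alpha>0$ the space $\mathcal{T}_2^{(\alpha)}(t^\alpha)$ consists of all $f\in L_2(\mathbb{R}^+)$ for which there is a (necessarily unique) element $W^\alpha f\in L_2(\mathbb{R}^+,t^{2\alpha})$ with $$f(t)=\frac{1}{\Gamma(\alpha)}\int_t^\infty(s-t)^{\alpha-1}W^\alpha f(s)\,ds\qquad(\ast)$$ (equivalently, it is the range of the operator $\mathcal{C}_\alpha^*f(s)=\alpha\int_s^\infty\frac{(u-s)^{\alpha-1}}{u^\alpha}f(u)\,du$ on $L_2(\mathbb{R}^+)$). It is a Hilbert space with inner product $(f|g)_{2,(\alpha)}=\int_0^\infty W^\alpha f(t)\,\overline{W^\alpha g(t)}\,t^{2\alpha}\,dt$. Values $f(t)$, $t>0$,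 of $f\in\mathcal{T}_2^{(\alpha)}(t^\alpha)$ are understood through the integral in $(\ast)$. The space is an RKHS when for every $t>0$ there exists $k_{\alpha,t}\in\mathcal{T}_2^{(\alpha)}(t^\alpha)$ such that $(f|k_{\alpha,t})_{2,(\alpha)}=f(t)$ for all $f\in\mathcal{T}_2^{(\alpha)}(t^\alpha)$; the reproducing kernel is then $k_\alpha(s,t):=k_{\alpha,t}(s)$. *)

theory Defs
  imports "HOL-Analysis.Analysis"
begin

text \<open>Elements of the function spaces are represented by Borel functions \<open>real \<Rightarrow> complex\<close>, of
  which only the almost-everywhere class on \<open>{0<..}\<close> matters; values outside \<open>{0<..}\<close> are ignored.\<close>

definition L2_pos :: "(real \<Rightarrow> complex) set" where
  "L2_pos = {g. set_borel_measurable lborel {0<..} g \<and>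
                set_integrable lborel {0<..} (\<lambda>t. (cmod (g t))\<^sup>2)}"

definition L2_pos_weighted :: "real \<Rightarrow> (real \<Rightarrow> complex) set" where
  "L2_pos_weighted \<alpha> = {g. set_borel_measurable lborel {0<..} g \<and>
                          (\<lambda>t. complex_of_real (t powr \<alpha>) * g t) \<in> L2_pos}"

text \<open>The Weyl fractional integral of order \<open>\<alpha>\<close>. Since a divergent Bochner integral has the value
  0 in HOL, its absolute convergence at a point is a separate predicate.\<close>

definition weyl_converges :: "real \<Rightarrow> (real \<Rightarrow> complex) \<Rightarrow> real \<Rightarrow> bool" where
  "weyl_converges \<alpha> w t \<longleftrightarrow>
     set_integrable lborel {t<..} (\<lambda>s. complex_of_real ((s - t) powr (\<alpha> - 1)) * w s)"

definition weyl_integral :: "real \<Rightarrow> (real \<Rightarrow> complex) \<Rightarrow> real \<Rightarrow> complex" where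
  "weyl_integral \<alpha> w t = complex_of_real (1 / Gamma \<alpha>) *
     (LINT s:{t<..}|lborel. complex_of_real ((s - t) powr (\<alpha> - 1)) * w s)"

definition is_weyl_derivative :: "real \<Rightarrow> (real \<Rightarrow> complex) \<Rightarrow> (real \<Rightarrow> complex) \<Rightarrow> bool" where
  "is_weyl_derivative \<alpha> f w \<longleftrightarrow> w \<in> L2_pos_weighted \<alpha> \<and>
     (AE t in lborel. 0 < t \<longrightarrow> weyl_converges \<alpha> w t \<and> f t = weyl_integral \<alpha> w t)"

definition T2 :: "real \<Rightarrow> (real \<Rightarrow> complex) set" where
  "T2 \<alpha> = {f \<in> L2_pos. \<exists>w. is_weyl_derivative \<alpha> f w}"

text \<open>The fractional derivative is determined up to null sets, so the choice is harmless: it is only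
  ever used under an integral sign.\<close>

definition weyl_derivative :: "real \<Rightarrow> (real \<Rightarrow> complex) \<Rightarrow> real \<Rightarrow> complex" where
  "weyl_derivative \<alpha> f = (SOME w. is_weyl_derivative \<alpha> f w)"

definition T2_inner :: "real \<Rightarrow> (real \<Rightarrow> complex) \<Rightarrow> (real \<Rightarrow> complex) \<Rightarrow> complex" where
  "T2_inner \<alpha> f g = (LINT t:{0<..}|lborel.
     weyl_derivative \<alpha> f t * cnj (weyl_derivative \<alpha> g t) * complex_of_real (t powr (2 * \<alpha>)))"

text \<open>Point values of \<open>f \<in> T2 \<alpha>\<close> are those of the Weyl integral, not of the chosen representative
  of the almost-everywhere class.\<close>

definition T2_has_value :: "real \<Rightarrow> (real \<Rightarrow> complex) \<Rightarrow> real \<Rightarrow> bool" where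
  "T2_has_value \<alpha> f t \<longleftrightarrow> weyl_converges \<alpha> (weyl_derivative \<alpha> f) t"

definition T2_value :: "real \<Rightarrow> (real \<Rightarrow> complex) \<Rightarrow> real \<Rightarrow> complex" where
  "T2_value \<alpha> f t = weyl_integral \<alpha> (weyl_derivative \<alpha> f) t"

definition represents_evaluation :: "real \<Rightarrow> real \<Rightarrow> (real \<Rightarrow> complex) \<Rightarrow> bool" where
  "represents_evaluation \<alpha> t k \<longleftrightarrow> k \<in> T2 \<alpha> \<and>
     (\<forall>f \<in> T2 \<alpha>. T2_has_value \<alpha> f t \<and> T2_inner \<alpha> f k = T2_value \<alpha> f t)"

definition T2_is_RKHS :: "real \<Rightarrow> bool" where
  "T2_is_RKHS \<alpha> \<longleftrightarrow> (\<forall>t>0. \<exists>k. represents_evaluation \<alpha> t k)"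

definition T2_reproducing_kernel :: "real \<Rightarrow> real \<Rightarrow> real \<Rightarrow> complex" where
  "T2_reproducing_kernel \<alpha> s t = T2_value \<alpha> (SOME k. represents_evaluation \<alpha> t k) s"

definition pos_part_powr :: "real \<Rightarrow> real \<Rightarrow> real" where
  "pos_part_powr x a = (if x > 0 then x powr a else 0)"

definition g_kernel :: "real \<Rightarrow> real \<Rightarrow> real \<Rightarrow> real" where
  "g_kernel \<alpha> t r = pos_part_powr (r - t) (\<alpha> - 1) / (r powr \<alpha> * Gamma \<alpha>)"

end

theory Submission
  imports Defs
begin

text \<open>Put \<open>h(r) = r\<^sup>\<alpha> W\<^sup>\<alpha>f(r)\<close>. Then \<open>f \<mapsto> h\<close> identifies the space with \<open>L\<^sub>2(0,\<infinity>)\<close>: every \<open>h\<close> occurs by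
  Hardy's inequality, and \<open>h\<close> is determined by \<open>f\<close> because the Weyl integral is injective. Under this
  identification \<open>f(t)\<close> is the integral of \<open>h\<close> against \<open>g_\<alpha>(t,\<cdot>)\<close>, so evaluation at \<open>t\<close> is represented by
  the function corresponding to \<open>g_\<alpha>(t,\<cdot>)\<close> when that is square integrable, that is for \<open>\<alpha> > 1/2\<close>. For
  \<open>\<alpha> \<le> 1/2\<close> the singularity of \<open>g_\<alpha>(t,\<cdot>)\<close> at \<open>t\<close> makes the integral diverge for some \<open>h\<close>.\<close>

section \<open>Beta integrals\<close>

text \<open>Inner product and point values both go through \<open>weyl_derivative\<close>, an
  arbitrary choice, so nothing can be computed before the derivative is known to be unique almost
  everywhere. Both directions use this: to pair \<open>f\<close> with the kernel function, and to
  know that the chosen derivative of the counterexample is the function it was built from.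
  Uniqueness is the main obstacle because \<open>w\<close> is controlled only through
  \<open>t powr \<alpha> * w t\<close> in L2. In general \<open>w\<close> is not integrable near 0,
  so the statements on tail integrals start at some \<open>a > 0\<close>; and raising the order to
  an integer by a second Weyl integral may diverge at infinity, so that step carries a decaying
  weight, chosen such that the inner integral is still an explicit Beta integral. In the negative
  direction no unbounded functional has to be exhibited: \<open>represents_evaluation\<close>
  demands convergence at \<open>t\<close> for every \<open>f\<close>, so one \<open>f\<close> with a
  divergent integral at one point suffices.\<close>

lemma Beta_real_nonneg: "a > 0 \<Longrightarrow> b > 0 \<Longrightarrow> Beta a b \<ge> (0 :: real)"
  by (simp add: Beta_def Gamma_real_nonneg)


text \<open>Two forms are needed: a substitution onto the whole of [0,1] gives an exact value, while
  the tail integral is treated on bounded intervals, whose images stop short of 1 and give only a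
  bound.\<close>

lemma nn_integral_Beta_substitution:
  fixes g g' :: "real \<Rightarrow> real"
  assumes "p > 0" "q > 0" "a \<le> b" "0 \<le> g a" "g b \<le> 1"
    and "\<And>x. x \<in> {a..b} \<Longrightarrow> (g has_real_derivative g' x) (at x)"
    and "continuous_on {a..b} g'"
    and "\<And>x. x \<in> {a..b} \<Longrightarrow> g' x \<ge> 0"
  shows "(\<integral>\<^sup>+x. ennreal (g x powr (p - 1) * (1 - g x) powr (q - 1) * g' x) * indicator {a..b} x \<partial>lborel)
           \<le> ennreal (Beta p q)" (is "?I \<le> _")
    and "g a = 0 \<Longrightarrow> g b = 1 \<Longrightarrow>
         (\<integral>\<^sup>+x. ennreal (g x powr (p - 1) * (1 - g x) powr (q - 1) * g' x) * indicator {a..b} x \<partial>lborel)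
           = ennreal (Beta p q)"
proof -
  define f where "f = (\<lambda>y::real. y powr (p - 1) * (1 - y) powr (q - 1))"
  have Beta: "(\<integral>\<^sup>+y. ennreal (f y) * indicator {0..1} y \<partial>lborel) = ennreal (Beta p q)"
    unfolding f_def using has_integral_Beta_real[OF assms(1,2)]
    by (intro nn_integral_has_integral_lebesgue') auto
  have [measurable]: "f \<in> borel_measurable borel"
    unfolding f_def by measurable
  have I: "?I = (\<integral>\<^sup>+y. ennreal (f y) * indicator {g a..g b} y \<partial>lborel)"
    using nn_integral_substitution[of g a b f g'] assms(3,6,7,8)
    by (simp add: f_def set_borel_measurable_def nn_integral_set_ennreal)
  show "?I \<le> ennreal (Beta p q)"
    unfolding I Beta[symmetric] using assms(4,5)
    by (intro nn_integral_mono) (auto split: split_indicator)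
  show "?I = ennreal (Beta p q)" if "g a = 0" "g b = 1"
    using I Beta that by simp
qed

text \<open>Substitution \<open>y = t / r\<close>. This evaluates the column integrals in Schur's
  test.\<close>

lemma nn_integral_Beta_scaled:
  fixes p q r :: real
  assumes p: "p > 0" and q: "q > 0" and r: "r > 0"
  shows "(\<integral>\<^sup>+t. ennreal (t powr (p - 1) * (r - t) powr (q - 1)) * indicator {0..r} t \<partial>lborel)
          = ennreal (Beta p q * r powr (p + q - 1))"
proof -
  have "(\<integral>\<^sup>+t. ennreal (t powr (p - 1) * (r - t) powr (q - 1)) * indicator {0..r} t \<partial>lborel)
      = (\<integral>\<^sup>+t. ennreal (r powr (p + q - 1)) * (ennreal ((t / r) powr (p - 1) * (1 - t / r) powr (q - 1) * (1 / r))
              * indicator {0..r} t) \<partial>lborel)"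
  proof (intro nn_integral_cong)
    fix t :: real
    have "t powr (p - 1) * (r - t) powr (q - 1)
        = r powr (p + q - 1) * ((t / r) powr (p - 1) * (1 - t / r) powr (q - 1) * (1 / r))" if "t \<in> {0..r}"
    proof -
      have "1 - t / r = (r - t) / r"
        using r by (simp add: field_simps)
      moreover have "r powr (p + q - 1) = r powr (p - 1) * r powr (q - 1) * r"
        using r by (simp add: powr_add[symmetric] powr_mult_base mult.commute)
      ultimately show ?thesis
        using that r by (simp add: powr_divide field_simps)
    qed
    then show "ennreal (t powr (p - 1) * (r - t) powr (q - 1)) * indicator {0..r} t
      = ennreal (r powr (p + q - 1)) * (ennreal ((t / r) powr (p - 1) * (1 - t / r) powr (q - 1) * (1 / r))
              * indicator {0..r} t)"
      using r by (auto simp: ennreal_mult[symmetric] split: split_indicator)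
  qed
  also have "\<dots> = ennreal (r powr (p + q - 1)) *
      (\<integral>\<^sup>+t. ennreal ((t / r) powr (p - 1) * (1 - t / r) powr (q - 1) * (1 / r)) * indicator {0..r} t \<partial>lborel)"
    by (rule nn_integral_cmult) measurable
  also have "(\<integral>\<^sup>+t. ennreal ((t / r) powr (p - 1) * (1 - t / r) powr (q - 1) * (1 / r)) * indicator {0..r} t \<partial>lborel)
      = ennreal (Beta p q)"
    by (rule nn_integral_Beta_substitution(2))
       (use assms in \<open>auto intro!: derivative_eq_intros\<close>)
  finally show ?thesis
    using p q by (simp add: ennreal_mult[symmetric] Beta_real_nonneg mult.commute)
qed

text \<open>The substitution \<open>y = 1 - t / r\<close> maps the half-line beyond \<open>t\<close>
  to (0,1). Bounded pieces are estimated first and then exhausted by monotone convergence. The bound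
  serves for the rows in Schur's test (\<open>q = 1/2\<close>), for \<open>1 / s\<close> in L2 away
  from 0 (\<open>p = q = 1\<close>) and for the norm of \<open>g_kernel\<close>
  (\<open>p = 2 * \<alpha> - 1\<close>, \<open>q = 1\<close>).\<close>

lemma nn_integral_Beta_tail:
  fixes p q t :: real
  assumes p: "p > 0" and q: "q > 0" and t: "t > 0"
  shows "(\<integral>\<^sup>+r. ennreal ((r - t) powr (p - 1) * r powr (- p - q)) * indicator {t<..} r \<partial>lborel)
          \<le> ennreal (Beta p q * t powr (- q))"
proof -
  define F where "F = (\<lambda>N r. ennreal ((r - t) powr (p - 1) * r powr (- p - q)) * indicator {t..t + real N} r)"
  have bound: "(\<integral>\<^sup>+r. F N r \<partial>lborel) \<le> ennreal (Beta p q * t powr (- q))" for N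
  proof -
    have "(\<integral>\<^sup>+r. F N r \<partial>lborel)
      = (\<integral>\<^sup>+r. ennreal (t powr (- q)) * (ennreal ((1 - t / r) powr (p - 1) * (1 - (1 - t / r)) powr (q - 1) * (t / r\<^sup>2))
              * indicator {t..t + real N} r) \<partial>lborel)"
    proof (intro nn_integral_cong)
      fix r :: real
      have "(r - t) powr (p - 1) * r powr (- p - q)
        = t powr (- q) * ((1 - t / r) powr (p - 1) * (1 - (1 - t / r)) powr (q - 1) * (t / r\<^sup>2))" if "t \<le> r"
      proof -
        have r: "r > 0" using t that by simp
        have "1 - t / r = (r - t) / r"
          using r by (simp add: field_simps)
        moreover have "r powr (- p - q) = 1 / (r powr (p - 1) * r powr (q - 1) * r\<^sup>2)"
          using r by (simp add: powr_numeral[symmetric] powr_add[symmetric] powr_minus_divide[symmetric] del: powr_numeral)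
        moreover have "t powr (- q) = 1 / (t powr (q - 1) * t)"
          using t by (simp add: powr_minus_divide powr_mult_base mult.commute)
        ultimately show ?thesis
          using that r t by (simp add: powr_divide field_simps)
      qed
      then show "F N r = ennreal (t powr (- q)) * (ennreal ((1 - t / r) powr (p - 1) * (1 - (1 - t / r)) powr (q - 1) * (t / r\<^sup>2))
              * indicator {t..t + real N} r)"
        using t by (auto simp: F_def ennreal_mult[symmetric] split: split_indicator)
    qed
    also have "\<dots> = ennreal (t powr (- q)) *
       (\<integral>\<^sup>+r. ennreal ((1 - t / r) powr (p - 1) * (1 - (1 - t / r)) powr (q - 1) * (t / r\<^sup>2)) * indicator {t..t + real N} r \<partial>lborel)"
      by (rule nn_integral_cmult) measurable
    also have "\<dots> \<le> ennreal (t powr (- q)) * ennreal (Beta p q)"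
      by (intro mult_left_mono nn_integral_Beta_substitution(1))
         (use assms in \<open>auto intro!: derivative_eq_intros continuous_intros simp: power2_eq_square\<close>)
    finally show ?thesis
      using p q by (simp add: ennreal_mult[symmetric] Beta_real_nonneg mult.commute)
  qed
  have "(\<integral>\<^sup>+r. ennreal ((r - t) powr (p - 1) * r powr (- p - q)) * indicator {t<..} r \<partial>lborel)
      \<le> (\<integral>\<^sup>+r. (SUP N. F N r) \<partial>lborel)"
  proof (intro nn_integral_mono)
    fix r :: real
    obtain N where "r \<le> t + real N"
      using real_arch_simple[of "r - t"] by (auto simp: algebra_simps)
    then have "ennreal ((r - t) powr (p - 1) * r powr (- p - q)) * indicator {t<..} r \<le> F N r"
      by (auto simp: F_def split: split_indicator)
    then show "ennreal ((r - t) powr (p - 1) * r powr (- p - q)) * indicator {t<..} r \<le> (SUP N. F N r)"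
      by (meson SUP_upper2 UNIV_I)
  qed
  also have "\<dots> = (SUP N. \<integral>\<^sup>+r. F N r \<partial>lborel)"
    by (intro nn_integral_monotone_convergence_SUP)
       (auto simp: F_def incseq_def le_fun_def split: split_indicator)
  also have "\<dots> \<le> ennreal (Beta p q * t powr (- q))"
    using bound by (rule SUP_least)
  finally show ?thesis .
qed

text \<open>The three exponents add up to -2, so a Moebius map in \<open>t\<close> leaves no stray
  power of \<open>t\<close> behind. The map \<open>g\<close>, equal to
  \<open>s * (t - a) / ((s - a) * t)\<close>, sends \<open>a\<close> to 0 and \<open>s\<close> to 1
  and so produces the plain Beta integral; the powers of \<open>s - a\<close>, \<open>s\<close> and
  \<open>a\<close> are its scaling factors. For integer \<open>p + q\<close> the power of
  \<open>s - a\<close> is an integer power.\<close>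

lemma nn_integral_Beta_weighted:
  fixes p q a s :: real
  assumes p: "p > 0" and q: "q > 0" and a: "0 < a" "a < s"
  shows "(\<integral>\<^sup>+t. ennreal ((t - a) powr (p - 1) * t powr (- p - q) * (s - t) powr (q - 1)) * indicator {a..s} t \<partial>lborel)
          = ennreal (Beta p q * ((s - a) powr (p + q - 1) * s powr (- p) * a powr (- q)))"
proof -
  define C where "C = (s - a) powr (p + q - 1) * s powr (- p) * a powr (- q)"
  define c where "c = s / (s - a)"
  define g where "g = (\<lambda>t. c * (1 - a / t))"
  define g' where "g' = (\<lambda>t::real. c * (a / t\<^sup>2))"
  have c: "c > 0" "c * (1 - a / s) = 1"
    using a by (auto simp: c_def field_simps)
  have "(\<integral>\<^sup>+t. ennreal ((t - a) powr (p - 1) * t powr (- p - q) * (s - t) powr (q - 1)) * indicator {a..s} t \<partial>lborel)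
    = (\<integral>\<^sup>+t. ennreal C * (ennreal (g t powr (p - 1) * (1 - g t) powr (q - 1) * g' t) * indicator {a..s} t) \<partial>lborel)"
  proof (intro nn_integral_cong)
    fix t :: real
    have "(t - a) powr (p - 1) * t powr (- p - q) * (s - t) powr (q - 1)
      = C * (g t powr (p - 1) * (1 - g t) powr (q - 1) * g' t)" if "t \<in> {a..s}"
    proof -
      have t: "t > 0" using a that by simp
      have g: "g t = s * (t - a) / ((s - a) * t)" "1 - g t = a * (s - t) / ((s - a) * t)"
        using a t by (auto simp: g_def c_def field_simps)
      have pt: "t powr (- p - q) = 1 / (t powr (p - 1) * t powr (q - 1) * t\<^sup>2)"
        using t by (simp add: powr_numeral[symmetric] powr_add[symmetric] powr_minus_divide[symmetric] del: powr_numeral)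
      have C: "C = ((s - a) powr (p - 1) * (s - a) powr (q - 1) * (s - a)) / ((s powr (p - 1) * s) * (a powr (q - 1) * a))"
        using a by (simp add: C_def powr_add[symmetric] powr_minus_divide powr_mult_base mult.commute)
      show ?thesis
        unfolding g(2) unfolding g(1) g'_def c_def pt C using that a t by (simp add: powr_divide powr_mult)
    qed
    then show "ennreal ((t - a) powr (p - 1) * t powr (- p - q) * (s - t) powr (q - 1)) * indicator {a..s} t
      = ennreal C * (ennreal (g t powr (p - 1) * (1 - g t) powr (q - 1) * g' t) * indicator {a..s} t)"
      using a c by (auto simp: C_def g'_def ennreal_mult[symmetric] split: split_indicator)
  qed
  also have "\<dots> = ennreal C *
      (\<integral>\<^sup>+t. ennreal (g t powr (p - 1) * (1 - g t) powr (q - 1) * g' t) * indicator {a..s} t \<partial>lborel)"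
    unfolding g_def g'_def by (rule nn_integral_cmult) measurable
  also have "(\<integral>\<^sup>+t. ennreal (g t powr (p - 1) * (1 - g t) powr (q - 1) * g' t) * indicator {a..s} t \<partial>lborel)
      = ennreal (Beta p q)"
    by (rule nn_integral_Beta_substitution(2))
       (use assms c in \<open>auto intro!: derivative_eq_intros continuous_intros
          simp: g_def g'_def power2_eq_square simp del: right_diff_distrib'\<close>)
  finally show ?thesis
    using p q by (simp add: ennreal_mult[symmetric] Beta_real_nonneg mult.commute C_def)
qed

section \<open>Functions with vanishing tail integrals\<close>

text \<open>Half-lines are an intersection-stable generator of the Borel sets, so Dynkin's argument
  extends the vanishing of the integral to every Borel set. The integral over the whole line, a
  limit of tail integrals, is what the complement step subtracts from.\<close>

lemma AE_zero_if_tail_integrals_zero: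
  fixes F :: "real \<Rightarrow> 'a :: {banach, second_countable_topology}"
  assumes F: "integrable lborel F"
    and tail: "\<And>a. (LINT s:{a<..}|lborel. F s) = 0"
  shows "AE s in lborel. F s = 0"
proof (rule sigma_finite_measure.density_zero[OF lborel.sigma_finite_measure_axioms F])
  have int: "set_integrable lborel A F" if "A \<in> sets borel" for A
    using F that by (intro integrable_mult_indicator[folded set_integrable_def]) auto
  have UNIV: "(LINT s:UNIV|lborel. F s) = 0"
  proof -
    have "(\<lambda>n. LINT s:{- real n<..}|lborel. F s) \<longlonglongrightarrow> (LINT s:(\<Union>n. {- real n<..})|lborel. F s)"
      using int by (intro set_integral_cont_up) (auto simp: incseq_def)
    moreover have "(\<Union>n. {- real n<..}) = UNIV"
      using reals_Archimedean2 by (auto simp: minus_less_iff)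
    ultimately show ?thesis
      using tail by (simp add: LIMSEQ_const_iff)
  qed
  fix A :: "real set"
  assume "A \<in> sets lborel"
  then have A: "A \<in> sigma_sets UNIV (range greaterThan)"
    by (simp add: borel_Ioi)
  have "Int_stable (range greaterThan :: real set set)"
    unfolding Int_stable_def by (auto simp: greaterThan_def Collect_conj_eq[symmetric] max_less_iff_conj[symmetric] simp del: max_less_iff_conj)
  moreover have "range greaterThan \<subseteq> Pow (UNIV :: real set)"
    by simp
  ultimately show "(LINT s:A|lborel. F s) = 0" using A
  proof (induction rule: sigma_sets_induct_disjoint)
    case (basic A)
    then show ?case using tail by auto
  next
    case empty
    then show ?case by (simp add: set_lebesgue_integral_def)
  next
    case (compl A)
    then have A: "A \<in> sets borel" by (simp add: borel_Ioi)
    have "(LINT s:UNIV|lborel. F s) = (LINT s:A \<union> (UNIV - A)|lborel. F s)" by simp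
    also have "\<dots> = (LINT s:A|lborel. F s) + (LINT s:UNIV - A|lborel. F s)"
      using int A by (intro set_integral_Un) auto
    finally show ?case using UNIV compl by simp
  next
    case (union A)
    then have A: "A i \<in> sets borel" for i by (auto simp: borel_Ioi)
    have "(LINT s:(\<Union>i. A i)|lborel. F s) = (\<Sum>i. (LINT s:A i|lborel. F s))"
      using union(1) A int by (intro lebesgue_integral_countable_add) (auto simp: disjoint_family_on_def)
    then show ?case using union by simp
  qed
qed

lemma AE_positive_dense:
  fixes a b :: real
  assumes "AE x in lborel. 0 < x \<longrightarrow> P x" "0 \<le> a" "a < b"
  obtains x where "a < x" "x < b" "P x"
proof -
  have "\<exists>x. a < x \<and> x < b \<and> P x"
  proof (rule ccontr)
    assume "\<not> ?thesis"
    then have "AE x in lborel. x \<notin> {a<..<b}"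
      using assms by (auto elim!: eventually_mono)
    then have "emeasure lborel {a<..<b} = 0"
      by (subst (asm) AE_iff_measurable[OF _ refl]) (auto simp: greaterThanLessThan_eq greaterThan_def lessThan_def Collect_conj_eq)
    then show False using \<open>a < b\<close> by simp
  qed
  then show thesis using that by blast
qed

text \<open>Reduces a claim on the positive axis to half-lines that stay away from 0, where the
  functions in question are integrable.\<close>

lemma AE_positive_iff_countable:
  "(AE x in lborel. 0 < x \<longrightarrow> P x) \<longleftrightarrow> (\<forall>n. AE x in lborel. 1 / real (Suc n) < x \<longrightarrow> P x)"
proof -
  have "0 < x \<longleftrightarrow> (\<exists>n. 1 / real (Suc n) < x)" for x :: real
    using nat_approx_posE[of x] by (metis divide_pos_pos less_trans of_nat_0_less_iff zero_less_Suc zero_less_one)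
  then show ?thesis
    unfolding AE_all_countable[symmetric] by auto
qed

text \<open>Weakens the previous criterion twice: integrability only away from 0, and vanishing
  tails only for almost every \<open>a\<close>. Tail integrals depend continuously on their left end
  from the right, so the exceptional null set disappears.\<close>

lemma AE_zero_if_AE_tail_integrals_zero:
  fixes F :: "real \<Rightarrow> 'a :: {banach, second_countable_topology}"
  assumes int: "\<And>a. a > 0 \<Longrightarrow> set_integrable lborel {a<..} F"
    and tail: "AE a in lborel. 0 < a \<longrightarrow> (LINT s:{a<..}|lborel. F s) = 0"
  shows "AE s in lborel. 0 < s \<longrightarrow> F s = 0"
proof -
  have all: "(LINT s:{a<..}|lborel. F s) = 0" if "a > 0" for a
  proof -
    \<comment> \<open>A full-measure set meets every interval to the right of \<open>a\<close>, so
      good points can be chosen decreasing towards \<open>a\<close> within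
      \<open>1 / real (Suc n)\<close>.\<close>
    have "\<exists>x>a. x < a + 1 / real (Suc n) \<and> (LINT s:{x<..}|lborel. F s) = 0" for n
      using AE_positive_dense[OF tail, of a "a + 1 / real (Suc n)"] that by fastforce
    then obtain x where x: "x n > a" "x n < a + 1 / real (Suc n)" "(LINT s:{x n<..}|lborel. F s) = 0" for n
      by metis
    have lim: "x \<longlonglongrightarrow> a"
    proof (rule real_tendsto_sandwich[of "\<lambda>_. a" _ _ "\<lambda>n. a + 1 / real (Suc n)"])
      show "(\<lambda>n. a + 1 / real (Suc n)) \<longlonglongrightarrow> a"
        using tendsto_add[OF tendsto_const LIMSEQ_Suc[OF lim_1_over_n], of a] by simp
    qed (use x in \<open>auto intro!: always_eventually less_imp_le\<close>)
    have "(\<lambda>n. LINT s:{x n<..}|lborel. F s) \<longlonglongrightarrow> (LINT s:{a<..}|lborel. F s)"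
      unfolding set_lebesgue_integral_def
    proof (rule integral_dominated_convergence)
      show "(\<lambda>s. indicator {a<..} s *\<^sub>R F s) \<in> borel_measurable lborel"
        using int[OF that] unfolding set_integrable_def by auto
      show "(\<lambda>s. indicator {x n<..} s *\<^sub>R F s) \<in> borel_measurable lborel" for n
        using int[of "x n"] x(1)[of n] that unfolding set_integrable_def by auto
      show "integrable lborel (\<lambda>s. norm (indicator {a<..} s *\<^sub>R F s))"
        using int[OF that] unfolding set_integrable_def by (rule integrable_norm)
      show "AE s in lborel. (\<lambda>n. indicator {x n<..} s *\<^sub>R F s) \<longlonglongrightarrow> indicator {a<..} s *\<^sub>R F s"
      proof (intro AE_I2 tendsto_scaleR tendsto_const)
        fix s
        show "(\<lambda>n. indicat_real {x n<..} s) \<longlonglongrightarrow> indicator {a<..} s"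
        proof (cases "a < s")
          case True
          then have "eventually (\<lambda>n. x n < s) sequentially"
            using lim by (rule order_tendstoD(2)[rotated])
          then show ?thesis
            using True by (intro tendsto_eventually) (auto elim!: eventually_mono)
        next
          case False
          then have "s \<notin> {x n<..}" for n using x(1)[of n] by auto
          then show ?thesis using False by simp
        qed
      qed
      show "AE s in lborel. norm (indicator {x n<..} s *\<^sub>R F s) \<le> norm (indicator {a<..} s *\<^sub>R F s)" for n
        using x(1)[of n] by (auto split: split_indicator)
    qed
    then show ?thesis using x(3) by (simp add: LIMSEQ_const_iff)
  qed
  show ?thesis
    unfolding AE_positive_iff_countable
  proof
    fix n
    define c where "c = 1 / real (Suc n)"
    have "AE s in lborel. indicator {c<..} s *\<^sub>R F s = 0"
    proof (rule AE_zero_if_tail_integrals_zero)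
      show "integrable lborel (\<lambda>s. indicator {c<..} s *\<^sub>R F s)"
        using int[of c] by (simp add: set_integrable_def c_def)
      \<comment> \<open>The cut-off at \<open>c\<close> admits every real \<open>a\<close>, also
        negative ones: its tail beyond \<open>a\<close> is the tail of \<open>F\<close> beyond
        \<open>max a c\<close>, which is positive.\<close>
      have "(LINT s:{a<..}|lborel. indicator {c<..} s *\<^sub>R F s) = (LINT s:{max a c<..}|lborel. F s)" for a
        unfolding set_lebesgue_integral_def
        by (intro Bochner_Integration.integral_cong) (auto split: split_indicator)
      then show "(LINT s:{a<..}|lborel. indicator {c<..} s *\<^sub>R F s) = 0" for a
        using all[of "max a c"] by (simp add: c_def max.strict_coboundedI2)
    qed
    then show "AE s in lborel. 1 / real (Suc n) < s \<longrightarrow> F s = 0"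
      unfolding c_def by eventually_elim (auto split: split_indicator_asm)
  qed
qed

text \<open>Since the kernel is nonnegative with column integrals \<open>\<Phi>\<close> in closed
  form, integrating the norm over \<open>t\<close> first gives \<open>\<Phi> s * norm (F s)\<close>.
  Integrability on the product thus reduces to the one-dimensional hypothesis
  \<open>int\<close>.\<close>

lemma kernel_Fubini:
  fixes \<kappa> :: "real \<Rightarrow> real \<Rightarrow> real" and F :: "real \<Rightarrow> 'a :: {banach, second_countable_topology}"
  assumes [measurable]: "(\<lambda>(t, s). \<kappa> t s) \<in> borel_measurable (borel \<Otimes>\<^sub>M borel)" "F \<in> borel_measurable borel"
    and nonneg: "\<And>t s. \<kappa> t s \<ge> 0" "\<And>s. \<Phi> s \<ge> 0"
    and \<Phi>: "\<And>s. (\<integral>\<^sup>+t. ennreal (\<kappa> t s) \<partial>lborel) = ennreal (\<Phi> s)"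
    and int: "integrable lborel (\<lambda>s. \<Phi> s *\<^sub>R F s)"
  shows "AE t in lborel. integrable lborel (\<lambda>s. \<kappa> t s *\<^sub>R F s)"
    and "integrable lborel (\<lambda>t. LINT s|lborel. \<kappa> t s *\<^sub>R F s)"
    and "(LINT t|lborel. LINT s|lborel. \<kappa> t s *\<^sub>R F s) = (LINT s|lborel. \<Phi> s *\<^sub>R F s)"
proof -
  have i: "integrable lborel (\<lambda>t. \<kappa> t s)" for s
    using \<Phi>[of s] nonneg by (intro integrableI_nonneg) auto
  have I: "(LINT t|lborel. \<kappa> t s) = \<Phi> s" for s
    using \<Phi>[of s] nonneg by (subst integral_eq_nn_integral) auto
  have "integrable (lborel \<Otimes>\<^sub>M lborel) (\<lambda>(s, t). \<kappa> t s *\<^sub>R F s)"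
  proof (rule lborel_pair.Fubini_integrable)
    show "(\<lambda>(s, t). \<kappa> t s *\<^sub>R F s) \<in> borel_measurable (lborel \<Otimes>\<^sub>M lborel)"
      by measurable
    have "(LINT t|lborel. norm (\<kappa> t s *\<^sub>R F s)) = norm (\<Phi> s *\<^sub>R F s)" for s
      using nonneg i[of s] by (simp add: I)
    then show "integrable lborel (\<lambda>s. LINT t|lborel. norm (case (s, t) of (s, t) \<Rightarrow> \<kappa> t s *\<^sub>R F s))"
      using integrable_norm[OF int] by (simp del: norm_scaleR)
    show "AE s in lborel. integrable lborel (\<lambda>t. case (s, t) of (s, t) \<Rightarrow> \<kappa> t s *\<^sub>R F s)"
      using i by simp
  qed
  then have pair: "integrable (lborel \<Otimes>\<^sub>M lborel) (\<lambda>(t, s). \<kappa> t s *\<^sub>R F s)"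
    by (subst lborel_pair.integrable_product_swap_iff[symmetric]) simp
  show "AE t in lborel. integrable lborel (\<lambda>s. \<kappa> t s *\<^sub>R F s)"
    using lborel_pair.AE_integrable_fst[OF pair] .
  show "integrable lborel (\<lambda>t. LINT s|lborel. \<kappa> t s *\<^sub>R F s)"
    using lborel_pair.integrable_fst[OF pair] .
  show "(LINT t|lborel. LINT s|lborel. \<kappa> t s *\<^sub>R F s) = (LINT s|lborel. \<Phi> s *\<^sub>R F s)"
    unfolding lborel_pair.Fubini_integral[OF pair, symmetric] using i by (simp add: I)
qed

lemma set_integrable_weaken:
  fixes F :: "real \<Rightarrow> complex"
  assumes F: "F \<in> borel_measurable borel" and G: "set_integrable lborel {a<..} G"
    and le: "\<And>s. s > a \<Longrightarrow> cmod (F s) \<le> c * cmod (G s)"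
  shows "set_integrable lborel {a<..} F"
  unfolding set_integrable_def
proof (rule Bochner_Integration.integrable_bound)
  show "integrable lborel (\<lambda>s. c *\<^sub>R indicator {a<..} s *\<^sub>R (G s :: complex))"
    using G by (intro integrable_scaleR_right) (simp add: set_integrable_def)
  show "AE s in lborel. norm (indicator {a<..} s *\<^sub>R F s) \<le> norm (c *\<^sub>R indicator {a<..} s *\<^sub>R G s)"
    using le by (auto split: split_indicator simp: abs_mult intro!: AE_I2 order_trans[OF le] mult_right_mono)
  show "(\<lambda>s. indicator {a<..} s *\<^sub>R F s) \<in> borel_measurable lborel"
    using F by measurable
qed

text \<open>Integration replaces differentiation in \<open>a\<close>. With \<open>G\<close> the tail
  integral of order \<open>n\<close>, Fubini shows that the integral of \<open>G\<close> beyond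
  \<open>a\<close> is the tail integral of order \<open>Suc n\<close> divided by
  \<open>Suc n\<close>. So the hypothesis of order \<open>Suc n\<close> makes the tails of
  \<open>G\<close> vanish, hence \<open>G\<close> itself almost everywhere, which is the hypothesis
  of order \<open>n\<close>.\<close>

lemma AE_zero_if_power_tail_integrals_zero:
  fixes F :: "real \<Rightarrow> complex"
  assumes [measurable]: "F \<in> borel_measurable borel"
    and "\<And>a. a > 0 \<Longrightarrow> set_integrable lborel {a<..} (\<lambda>s. complex_of_real (s ^ n) * F s)"
    and "AE a in lborel. 0 < a \<longrightarrow> (LINT s:{a<..}|lborel. complex_of_real ((s - a) ^ n) * F s) = 0"
  shows "AE s in lborel. 0 < s \<longrightarrow> F s = 0"
  using assms(2,3)
proof (induction n)
  case 0
  then show ?case using AE_zero_if_AE_tail_integrals_zero[of F] by simp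
next
  case (Suc n)
  define G where "G = (\<lambda>b. LINT s:{b<..}|lborel. complex_of_real ((s - b) ^ n) * F s)"
  \<comment> \<open>For \<open>s > a\<close> one has \<open>s ^ n \<le> s ^ Suc n / a\<close>; this
    is why integrability is asked only away from 0.\<close>
  have int_n: "set_integrable lborel {a<..} (\<lambda>s. complex_of_real (s ^ n) * F s)" if "a > 0" for a
    by (rule set_integrable_weaken[OF _ Suc.prems(1)[OF that], of _ "1 / a"])
       (use that in \<open>auto simp: norm_mult norm_power field_simps intro!: mult_right_mono\<close>)
  have GI: "set_integrable lborel {a<..} G" "(LINT b:{a<..}|lborel. G b) =
      complex_of_real (1 / real (Suc n)) * (LINT s:{a<..}|lborel. complex_of_real ((s - a) ^ Suc n) * F s)"
    if a: "a > 0" for a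
  proof -
    define \<kappa> where "\<kappa> = (\<lambda>b s. if a < b \<and> b < s then (s - b) ^ n else (0 :: real))"
    define \<Phi> where "\<Phi> = (\<lambda>s. if a < s then (s - a) ^ Suc n / real (Suc n) else 0)"
    have m: "(\<lambda>(t, s). \<kappa> t s) \<in> borel_measurable (borel \<Otimes>\<^sub>M borel)"
      unfolding \<kappa>_def by measurable
    have \<Phi>: "(\<integral>\<^sup>+b. ennreal (\<kappa> b s) \<partial>lborel) = ennreal (\<Phi> s)" for s
    proof (cases "a < s")
      case True
      have "(\<integral>\<^sup>+b. ennreal (\<kappa> b s) \<partial>lborel) = (\<integral>\<^sup>+b. ennreal ((s - b) ^ n) * indicator {a..s} b \<partial>lborel)"
      proof (rule nn_integral_cong_AE)
        show "AE b in lborel. ennreal (\<kappa> b s) = ennreal ((s - b) ^ n) * indicator {a..s} b"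
          using AE_lborel_singleton[of a] AE_lborel_singleton[of s]
          by eventually_elim (auto simp: \<kappa>_def split: split_indicator)
      qed
      also have "\<dots> = ennreal (- ((s - s) ^ Suc n / real (Suc n)) - (- ((s - a) ^ Suc n / real (Suc n))))"
        by (rule nn_integral_FTC_Icc)
           (use True in \<open>auto intro!: derivative_eq_intros simp del: of_nat_Suc power_Suc\<close>)
      finally show ?thesis using True by (simp add: \<Phi>_def)
    next
      case False
      then have "\<kappa> b s = 0" for b by (auto simp: \<kappa>_def)
      then show ?thesis using False by (simp add: \<Phi>_def)
    qed
    have "set_integrable lborel {a<..} (\<lambda>s. complex_of_real ((s - a) ^ Suc n / real (Suc n)) * F s)"
    proof (rule set_integrable_weaken[OF _ Suc.prems(1)[OF that], of _ 1])
      fix s assume "s > a"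
      then have "(s - a) ^ Suc n / real (Suc n) \<le> s ^ Suc n / 1"
        using a by (intro frac_le power_mono) auto
      then show "cmod (complex_of_real ((s - a) ^ Suc n / real (Suc n)) * F s) \<le> 1 * cmod (complex_of_real (s ^ Suc n) * F s)"
        using a \<open>s > a\<close> mult_right_mono[OF _ norm_ge_zero, of "(s - a) ^ Suc n / real (Suc n)" "s ^ Suc n / 1" "F s"]
        unfolding norm_mult norm_of_real by (simp del: of_nat_Suc power_Suc)
    qed measurable
    also have "?this \<longleftrightarrow> integrable lborel (\<lambda>s. \<Phi> s *\<^sub>R F s)"
      unfolding set_integrable_def \<Phi>_def
      by (intro arg_cong[where f = "integrable lborel"] ext) (auto split: split_indicator simp: scaleR_conv_of_real)
    finally have int: "integrable lborel (\<lambda>s. \<Phi> s *\<^sub>R F s)" .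
    have k: "(LINT s|lborel. \<kappa> b s *\<^sub>R F s) = indicator {a<..} b *\<^sub>R G b" for b
      unfolding \<kappa>_def G_def set_lebesgue_integral_def
      by (auto intro!: Bochner_Integration.integral_cong split: split_indicator simp: scaleR_conv_of_real)
    have nonneg: "\<kappa> b s \<ge> 0" "\<Phi> s \<ge> 0" for b s
      by (auto simp: \<kappa>_def \<Phi>_def)
    note * = kernel_Fubini[OF m assms(1) nonneg \<Phi> int]
    show "set_integrable lborel {a<..} G"
      using *(2) by (simp add: k set_integrable_def)
    have "(LINT b:{a<..}|lborel. G b) = (LINT s|lborel. \<Phi> s *\<^sub>R F s)"
      using *(3) by (simp add: k set_lebesgue_integral_def)
    also have "\<dots> = (LINT s:{a<..}|lborel. complex_of_real (1 / real (Suc n)) * (complex_of_real ((s - a) ^ Suc n) * F s))"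
      unfolding \<Phi>_def set_lebesgue_integral_def
      by (intro Bochner_Integration.integral_cong) (auto split: split_indicator simp: scaleR_conv_of_real)
    finally show "(LINT b:{a<..}|lborel. G b) =
      complex_of_real (1 / real (Suc n)) * (LINT s:{a<..}|lborel. complex_of_real ((s - a) ^ Suc n) * F s)"
      by simp
  qed
  have "AE s in lborel. 0 < s \<longrightarrow> G s = 0"
  proof (rule AE_zero_if_AE_tail_integrals_zero)
    show "AE a in lborel. 0 < a \<longrightarrow> (LINT b:{a<..}|lborel. G b) = 0"
      using Suc.prems(2) by eventually_elim (simp add: GI)
  qed (rule GI)
  then show ?case
    using Suc.IH int_n unfolding G_def by blast
qed

section \<open>Weyl integrals of square-integrable functions\<close>

text \<open>Schur's test with the weight \<open>r powr (1/2)\<close>: \<open>row\<close> is Cauchy-Schwarz, \<open>col\<close> the integral of the majorant.\<close>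

lemma weighted_Hardy_inequality:
  fixes H :: "real \<Rightarrow> ennreal"
  assumes \<alpha>: "\<alpha> > 0" and [measurable]: "H \<in> borel_measurable borel"
  shows "(\<integral>\<^sup>+t. (\<integral>\<^sup>+r. ennreal ((r - t) powr (\<alpha> - 1) * r powr (- \<alpha>)) * H r * indicator {t<..} r \<partial>lborel)\<^sup>2
            * indicator {0<..} t \<partial>lborel)
      \<le> ennreal ((Beta \<alpha> (1/2))\<^sup>2) * (\<integral>\<^sup>+r. (H r)\<^sup>2 * indicator {0<..} r \<partial>lborel)"
proof -
  define B where "B = Beta \<alpha> (1/2)"
  have B: "B \<ge> 0" using \<alpha> by (simp add: B_def Beta_real_nonneg)
  define K where "K = (\<lambda>t r. if 0 < t \<and> t < r then ennreal (B * t powr (- (1/2)) * ((r - t) powr (\<alpha> - 1) * r powr (1/2 - \<alpha>))) * (H r)\<^sup>2 else 0)"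
  have K [measurable]: "(\<lambda>(t, r). K t r) \<in> borel_measurable (borel \<Otimes>\<^sub>M borel)"
    unfolding K_def by measurable
  have row: "(\<integral>\<^sup>+r. ennreal ((r - t) powr (\<alpha> - 1) * r powr (- \<alpha>)) * H r * indicator {t<..} r \<partial>lborel)\<^sup>2
      \<le> (\<integral>\<^sup>+r. K t r \<partial>lborel)" if t: "t > 0" for t
  proof -
    \<comment> \<open>\<open>u\<close> and \<open>v\<close> are the square root of the kernel times
      \<open>r powr (-1/4)\<close> and \<open>r powr (1/4)\<close>. The square of \<open>u\<close>
      then has the integral bounded by \<open>B * t powr (- (1/2))\<close>, and the square of
      \<open>v\<close> together with that factor makes up \<open>K\<close>.\<close>
    define u where "u = (\<lambda>r. (r - t) powr ((\<alpha> - 1) / 2) * r powr ((- \<alpha> - 1/2) / 2))"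
    define v where "v = (\<lambda>r. (r - t) powr ((\<alpha> - 1) / 2) * r powr ((1/2 - \<alpha>) / 2))"
    define f where "f = (\<lambda>r. ennreal (u r) * indicator {t<..} r)"
    define g where "g = (\<lambda>r. ennreal (v r) * H r * indicator {t<..} r)"
    have [measurable]: "u \<in> borel_measurable borel" "v \<in> borel_measurable borel"
      unfolding u_def v_def by measurable
    have nonneg: "u r \<ge> 0" "v r \<ge> 0" for r
      by (auto simp: u_def v_def)
    have half: "x powr (y / 2) * x powr (y / 2) = x powr y" for x y :: real
      by (simp add: powr_add[symmetric])
    have mid: "r powr ((- \<alpha> - 1/2) / 2) * r powr ((1/2 - \<alpha>) / 2) = r powr (- \<alpha>)" for r :: real
      by (simp add: powr_add[symmetric] diff_divide_distrib)
    have uv: "u r * v r = (r - t) powr (\<alpha> - 1) * r powr (- \<alpha>)" for r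
      unfolding u_def v_def half[of "r - t" "\<alpha> - 1", symmetric] mid[of r, symmetric] by (simp only: mult_ac)
    have uu: "u r ^ 2 = (r - t) powr (\<alpha> - 1) * r powr (- \<alpha> - 1/2)" for r
      unfolding u_def power2_eq_square half[of "r - t" "\<alpha> - 1", symmetric] half[of r "- \<alpha> - 1/2", symmetric]
      by (simp only: mult_ac)
    have vv: "v r ^ 2 = (r - t) powr (\<alpha> - 1) * r powr (1/2 - \<alpha>)" for r
      unfolding v_def power2_eq_square half[of "r - t" "\<alpha> - 1", symmetric] half[of r "1/2 - \<alpha>", symmetric]
      by (simp only: mult_ac)
    have fg: "f r * g r = ennreal ((r - t) powr (\<alpha> - 1) * r powr (- \<alpha>)) * H r * indicator {t<..} r" for r
      unfolding f_def g_def uv[symmetric] ennreal_mult[OF nonneg] by (simp add: mult_ac split: split_indicator)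
    have f2: "(f r)\<^sup>2 = ennreal ((r - t) powr (\<alpha> - 1) * r powr (- \<alpha> - 1/2)) * indicator {t<..} r" for r
      unfolding f_def uu[symmetric] by (simp add: ennreal_power nonneg split: split_indicator)
    have g2: "(g r)\<^sup>2 = ennreal ((r - t) powr (\<alpha> - 1) * r powr (1/2 - \<alpha>)) * (H r)\<^sup>2 * indicator {t<..} r" for r
      unfolding g_def vv[symmetric] by (simp add: ennreal_power nonneg power_mult_distrib split: split_indicator)
    have "(\<integral>\<^sup>+r. f r * g r \<partial>lborel)\<^sup>2 \<le> (\<integral>\<^sup>+r. (f r)\<^sup>2 \<partial>lborel) * (\<integral>\<^sup>+r. (g r)\<^sup>2 \<partial>lborel)"
      by (rule Cauchy_Schwarz_nn_integral) (auto simp: f_def g_def)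
    also have "\<dots> \<le> ennreal (B * t powr (- (1/2))) * (\<integral>\<^sup>+r. (g r)\<^sup>2 \<partial>lborel)"
      unfolding f2 B_def using nn_integral_Beta_tail[OF \<alpha> _ t, of "1/2"]
      by (intro mult_right_mono) auto
    also have "\<dots> = (\<integral>\<^sup>+r. ennreal (B * t powr (- (1/2))) * (g r)\<^sup>2 \<partial>lborel)"
      by (rule nn_integral_cmult[symmetric]) (auto simp: g_def)
    also have "\<dots> = (\<integral>\<^sup>+r. K t r \<partial>lborel)"
    proof (intro nn_integral_cong)
      fix r
      have "ennreal (B * t powr (- (1/2)) * ((r - t) powr (\<alpha> - 1) * r powr (1/2 - \<alpha>)))
          = ennreal (B * t powr (- (1/2))) * ennreal ((r - t) powr (\<alpha> - 1) * r powr (1/2 - \<alpha>))"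
        using B by (intro ennreal_mult) auto
      then show "ennreal (B * t powr (- (1/2))) * (g r)\<^sup>2 = K t r"
        using t unfolding g2 K_def by (simp add: mult_ac split: split_indicator)
    qed
    finally show ?thesis by (simp only: fg)
  qed
  have col: "(\<integral>\<^sup>+t. K t r \<partial>lborel) = ennreal (B\<^sup>2) * ((H r)\<^sup>2 * indicator {0<..} r)" for r
  proof (cases "r > 0")
    case True
    have "(\<integral>\<^sup>+t. K t r \<partial>lborel) = (\<integral>\<^sup>+t. ennreal (B * r powr (1/2 - \<alpha>)) * (H r)\<^sup>2 *
        (ennreal (t powr (1/2 - 1) * (r - t) powr (\<alpha> - 1)) * indicator {0..r} t) \<partial>lborel)"
    proof (rule nn_integral_cong_AE)
      show "AE t in lborel. K t r = ennreal (B * r powr (1/2 - \<alpha>)) * (H r)\<^sup>2 *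
        (ennreal (t powr (1/2 - 1) * (r - t) powr (\<alpha> - 1)) * indicator {0..r} t)"
        using AE_lborel_singleton[of 0] AE_lborel_singleton[of r]
      proof eventually_elim
        case (elim t)
        have "ennreal (B * t powr (- (1/2)) * ((r - t) powr (\<alpha> - 1) * r powr (1/2 - \<alpha>)))
          = ennreal (B * r powr (1/2 - \<alpha>)) * ennreal (t powr (- (1/2)) * (r - t) powr (\<alpha> - 1))"
          using B by (simp add: ennreal_mult[symmetric] mult_ac)
        then show ?case
          using elim by (auto simp: K_def mult_ac split: split_indicator)
      qed
    qed
    also have "\<dots> = ennreal (B * r powr (1/2 - \<alpha>)) * (H r)\<^sup>2 * ennreal (Beta (1/2) \<alpha> * r powr (1/2 + \<alpha> - 1))"
      using \<alpha> True by (subst nn_integral_cmult) (auto simp: nn_integral_Beta_scaled[of "1/2" \<alpha>, simplified])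
    also have "\<dots> = ennreal (B * r powr (1/2 - \<alpha>)) * ennreal (Beta (1/2) \<alpha> * r powr (1/2 + \<alpha> - 1)) * (H r)\<^sup>2"
      by (simp add: mult_ac)
    \<comment> \<open>The powers of \<open>r\<close> cancel because the kernel is homogeneous of
      degree -1, and the column constant \<open>Beta (1/2) \<alpha>\<close> is again
      \<open>B\<close>; hence the square of \<open>B\<close> in the final bound.\<close>
    also have "ennreal (B * r powr (1/2 - \<alpha>)) * ennreal (Beta (1/2) \<alpha> * r powr (1/2 + \<alpha> - 1)) = ennreal (B\<^sup>2)"
    proof -
      have "r powr (1/2 - \<alpha>) * r powr (1/2 + \<alpha> - 1) = 1"
        using True by (simp add: powr_add[symmetric])
      then have "(B * r powr (1/2 - \<alpha>)) * (Beta (1/2) \<alpha> * r powr (1/2 + \<alpha> - 1)) = B\<^sup>2"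
        unfolding B_def Beta_commute[of "1/2"] power2_eq_square
        by (metis (no_types, opaque_lifting) mult.assoc mult.left_commute mult.right_neutral)
      then show ?thesis
        using B by (subst ennreal_mult'[symmetric]) auto
    qed
    finally show ?thesis using True by simp
  next
    case False
    then have "K t r = 0" for t by (auto simp: K_def)
    then show ?thesis using False by simp
  qed
  have "(\<integral>\<^sup>+t. (\<integral>\<^sup>+r. ennreal ((r - t) powr (\<alpha> - 1) * r powr (- \<alpha>)) * H r * indicator {t<..} r \<partial>lborel)\<^sup>2
            * indicator {0<..} t \<partial>lborel) \<le> (\<integral>\<^sup>+t. \<integral>\<^sup>+r. K t r \<partial>lborel \<partial>lborel)"
    using row by (intro nn_integral_mono) (auto split: split_indicator)
  also have "\<dots> = (\<integral>\<^sup>+r. \<integral>\<^sup>+t. K t r \<partial>lborel \<partial>lborel)"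
    by (rule lborel_pair.Fubini'[symmetric]) measurable
  also have "\<dots> = ennreal (B\<^sup>2) * (\<integral>\<^sup>+r. (H r)\<^sup>2 * indicator {0<..} r \<partial>lborel)"
    unfolding col by (rule nn_integral_cmult) measurable
  finally show ?thesis by (simp add: B_def)
qed

section \<open>Square integrability and the weighted space\<close>

lemma set_integrable_mult_of_squares:
  fixes f g :: "'a \<Rightarrow> 'b :: {real_normed_algebra, banach, second_countable_topology}"
  assumes f: "set_borel_measurable M A f" "set_integrable M A (\<lambda>x. (norm (f x))\<^sup>2)"
    and g: "set_borel_measurable M A g" "set_integrable M A (\<lambda>x. (norm (g x))\<^sup>2)"
  shows "set_integrable M A (\<lambda>x. f x * g x)"
  unfolding set_integrable_def
proof (rule Bochner_Integration.integrable_bound)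
  show "integrable M (\<lambda>x. indicator A x *\<^sub>R ((norm (f x))\<^sup>2 + (norm (g x))\<^sup>2))"
    using set_integral_add(1)[OF f(2) g(2)] by (simp add: set_integrable_def)
  have "(\<lambda>x. (indicator A x *\<^sub>R f x) * (indicator A x *\<^sub>R g x)) \<in> borel_measurable M"
    using f(1) g(1) unfolding set_borel_measurable_def by (rule borel_measurable_times)
  also have "(\<lambda>x. (indicator A x *\<^sub>R f x) * (indicator A x *\<^sub>R g x)) = (\<lambda>x. indicator A x *\<^sub>R (f x * g x))"
    by (auto split: split_indicator)
  finally show "(\<lambda>x. indicator A x *\<^sub>R (f x * g x)) \<in> borel_measurable M" .
  have "norm (f x * g x) \<le> (norm (f x))\<^sup>2 + (norm (g x))\<^sup>2" for x
  proof -
    have "norm (f x * g x) \<le> norm (f x) * norm (g x)"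
      by (rule norm_mult_ineq)
    also have "\<dots> \<le> 2 * norm (f x) * norm (g x)"
      by simp
    also have "\<dots> \<le> (norm (f x))\<^sup>2 + (norm (g x))\<^sup>2"
      by (rule sum_squares_bound)
    finally show ?thesis .
  qed
  then show "AE x in M. norm (indicator A x *\<^sub>R (f x * g x)) \<le> norm (indicator A x *\<^sub>R ((norm (f x))\<^sup>2 + (norm (g x))\<^sup>2))"
    by (auto split: split_indicator)
qed

lemma set_integrable_nonnegI:
  fixes f :: "'a \<Rightarrow> real"
  assumes "set_borel_measurable M A f" "\<And>x. x \<in> A \<Longrightarrow> 0 \<le> f x"
    and "(\<integral>\<^sup>+x. ennreal (f x) * indicator A x \<partial>M) < \<infinity>"
  shows "set_integrable M A f"
  using assms unfolding set_integrable_def set_borel_measurable_def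
  by (intro integrableI_nonneg)
     (auto simp: nn_integral_set_ennreal mult.commute[of "indicator A _"] split: split_indicator)

text \<open>Restates membership through an extended nonnegative integral, so that it can be derived
  from estimates such as Hardy's without proving integrability beforehand.\<close>

lemma L2_pos_iff:
  "g \<in> L2_pos \<longleftrightarrow> (\<lambda>t. indicator {0<..} t *\<^sub>R g t) \<in> borel_measurable borel \<and>
     (\<integral>\<^sup>+t. ennreal ((cmod (g t))\<^sup>2) * indicator {0<..} t \<partial>lborel) < \<infinity>"
proof -
  have "set_integrable lborel {0<..} (\<lambda>t. (cmod (g t))\<^sup>2) \<longleftrightarrow>
     (\<integral>\<^sup>+t. ennreal ((cmod (g t))\<^sup>2) * indicator {0<..} t \<partial>lborel) < \<infinity>"
    if [measurable]: "(\<lambda>t. indicator {0<..} t *\<^sub>R g t) \<in> borel_measurable borel"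
  proof -
    have "(\<lambda>t. (cmod (indicator {0<..} t *\<^sub>R g t))\<^sup>2) \<in> borel_measurable borel"
      by measurable
    also have "(\<lambda>t. (cmod (indicator {0<..} t *\<^sub>R g t))\<^sup>2) = (\<lambda>t. indicator {0<..} t *\<^sub>R (cmod (g t))\<^sup>2)"
      by (auto split: split_indicator)
    finally have "(\<lambda>t. indicator {0<..} t *\<^sub>R (cmod (g t))\<^sup>2) \<in> borel_measurable borel" .
    moreover have "ennreal (norm (indicator {0<..} t *\<^sub>R (cmod (g t))\<^sup>2)) = ennreal ((cmod (g t))\<^sup>2) * indicator {0<..} t" for t :: real
      by (auto split: split_indicator)
    ultimately show ?thesis
      unfolding set_integrable_def integrable_iff_bounded by simp
  qed
  then show ?thesis
    unfolding L2_pos_def set_borel_measurable_def by auto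
qed

lemma L2_pos_weighted_iff:
  "w \<in> L2_pos_weighted \<alpha> \<longleftrightarrow> (\<lambda>t. indicator {0<..} t *\<^sub>R w t) \<in> borel_measurable borel \<and>
     (\<integral>\<^sup>+t. ennreal ((t powr \<alpha> * cmod (w t))\<^sup>2) * indicator {0<..} t \<partial>lborel) < \<infinity>"
proof -
  have "(\<lambda>t. indicator {0<..} t *\<^sub>R (complex_of_real (t powr \<alpha>) * w t)) \<in> borel_measurable borel"
    if [measurable]: "(\<lambda>t. indicator {0<..} t *\<^sub>R w t) \<in> borel_measurable borel"
  proof -
    have "(\<lambda>t. complex_of_real (t powr \<alpha>) * (indicator {0<..} t *\<^sub>R w t)) \<in> borel_measurable borel"
      by measurable
    then show ?thesis by simp
  qed
  then show ?thesis
    unfolding L2_pos_weighted_def set_borel_measurable_def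
    by (auto simp: L2_pos_iff norm_mult)
qed

lemma L2_pos_weighted_diff:
  assumes "v \<in> L2_pos_weighted \<alpha>" "w \<in> L2_pos_weighted \<alpha>"
  shows "(\<lambda>t. v t - w t) \<in> L2_pos_weighted \<alpha>"
proof -
  have meas: "(\<lambda>t. indicator {0<..} t *\<^sub>R v t) \<in> borel_measurable borel"
      "(\<lambda>t. indicator {0<..} t *\<^sub>R w t) \<in> borel_measurable borel"
    using assms by (auto simp: L2_pos_weighted_iff)
  have "(\<lambda>t. (t powr \<alpha> * cmod (indicator {0<..} t *\<^sub>R v t))\<^sup>2) \<in> borel_measurable borel"
      "(\<lambda>t. (t powr \<alpha> * cmod (indicator {0<..} t *\<^sub>R w t))\<^sup>2) \<in> borel_measurable borel"
    using meas by measurable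
  moreover have "(t powr \<alpha> * cmod (indicator {0<..} t *\<^sub>R u t))\<^sup>2 = (t powr \<alpha> * cmod (u t))\<^sup>2 * indicator {0<..} t"
    for u :: "real \<Rightarrow> complex" and t
    by (auto split: split_indicator)
  ultimately have sq: "(\<lambda>t. (t powr \<alpha> * cmod (v t))\<^sup>2 * indicator {0<..} t) \<in> borel_measurable borel"
      "(\<lambda>t. (t powr \<alpha> * cmod (w t))\<^sup>2 * indicator {0<..} t) \<in> borel_measurable borel"
    by simp_all
  have le: "(t powr \<alpha> * cmod (v t - w t))\<^sup>2 \<le> 2 * (t powr \<alpha> * cmod (v t))\<^sup>2 + 2 * (t powr \<alpha> * cmod (w t))\<^sup>2" for t
  proof -
    have "(t powr \<alpha> * cmod (v t - w t))\<^sup>2 \<le> (t powr \<alpha> * cmod (v t) + t powr \<alpha> * cmod (w t))\<^sup>2"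
      by (intro power_mono) (auto simp: distrib_left[symmetric] intro!: mult_left_mono norm_triangle_ineq4)
    also have "\<dots> \<le> 2 * (t powr \<alpha> * cmod (v t))\<^sup>2 + 2 * (t powr \<alpha> * cmod (w t))\<^sup>2"
      using sum_squares_bound[of "t powr \<alpha> * cmod (v t)" "t powr \<alpha> * cmod (w t)"]
      by (simp add: power2_sum)
    finally show ?thesis .
  qed
  have "(\<integral>\<^sup>+t. ennreal ((t powr \<alpha> * cmod (v t - w t))\<^sup>2) * indicator {0<..} t \<partial>lborel)
    \<le> (\<integral>\<^sup>+t. 2 * ennreal ((t powr \<alpha> * cmod (v t))\<^sup>2 * indicator {0<..} t)
           + 2 * ennreal ((t powr \<alpha> * cmod (w t))\<^sup>2 * indicator {0<..} t) \<partial>lborel)"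
    using le by (intro nn_integral_mono)
      (auto simp: ennreal_plus[symmetric] ennreal_mult[symmetric] ennreal_numeral[symmetric]
         simp del: ennreal_plus ennreal_numeral split: split_indicator)
  also have "\<dots> = 2 * (\<integral>\<^sup>+t. ennreal ((t powr \<alpha> * cmod (v t))\<^sup>2 * indicator {0<..} t) \<partial>lborel)
           + 2 * (\<integral>\<^sup>+t. ennreal ((t powr \<alpha> * cmod (w t))\<^sup>2 * indicator {0<..} t) \<partial>lborel)"
    using sq by (subst nn_integral_add) (auto simp: nn_integral_cmult)
  also have "\<dots> < \<infinity>"
    using assms by (auto simp: L2_pos_weighted_iff nn_integral_set_ennreal ennreal_mult_less_top)
  finally show ?thesis
    using borel_measurable_diff[OF meas] by (simp add: L2_pos_weighted_iff scaleR_diff_right)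
qed

text \<open>Measurability of \<open>w\<close> is known only after the cut-off to the positive axis.
  For \<open>t \<ge> 0\<close> the integral runs over positive \<open>s\<close>, so the cut-off
  version, which is Borel on the whole line, may replace \<open>w\<close>. The next lemma does the
  same for the value.\<close>

lemma weyl_converges_iff:
  assumes "t \<ge> 0"
  shows "weyl_converges \<alpha> w t \<longleftrightarrow>
    integrable lborel (\<lambda>s. (indicator {t<..} s * (s - t) powr (\<alpha> - 1)) *\<^sub>R (indicator {0<..} s *\<^sub>R w s))"
  unfolding weyl_converges_def set_integrable_def using assms
  by (intro arg_cong[where f = "integrable lborel"] ext) (auto split: split_indicator simp: scaleR_conv_of_real)

lemma weyl_integral_eq:
  assumes "t \<ge> 0"
  shows "weyl_integral \<alpha> w t = complex_of_real (1 / Gamma \<alpha>) *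
    (LINT s|lborel. (indicator {t<..} s * (s - t) powr (\<alpha> - 1)) *\<^sub>R (indicator {0<..} s *\<^sub>R w s))"
  unfolding weyl_integral_def set_lebesgue_integral_def using assms
  by (intro arg_cong2[where f = times] refl Bochner_Integration.integral_cong)
     (auto split: split_indicator simp: scaleR_conv_of_real)

text \<open>Hardy's inequality is applied to \<open>s powr \<alpha> * cmod (w s)\<close>; the inner
  integral \<open>I\<close> is then the integral of the norm of the Weyl integrand. Its square being
  integrable makes \<open>I\<close> finite almost everywhere, which is convergence, and
  \<open>I\<close> divided by \<open>Gamma \<alpha>\<close> dominates the Weyl integral, which is
  square integrability.\<close>

lemma weyl_integral_is_weyl_derivative:
  assumes \<alpha>: "\<alpha> > 0" and w: "w \<in> L2_pos_weighted \<alpha>"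
  shows "weyl_integral \<alpha> w \<in> L2_pos" "is_weyl_derivative \<alpha> (weyl_integral \<alpha> w) w"
proof -
  define W where "W = (\<lambda>s. indicator {0<..} s *\<^sub>R w s)"
  have [measurable]: "W \<in> borel_measurable borel"
    using w by (simp add: W_def L2_pos_weighted_iff)
  define H where "H = (\<lambda>s. ennreal (s powr \<alpha> * cmod (W s)))"
  have [measurable]: "H \<in> borel_measurable borel"
    unfolding H_def by measurable
  define I where "I = (\<lambda>t. \<integral>\<^sup>+s. ennreal ((s - t) powr (\<alpha> - 1) * s powr (- \<alpha>)) * H s * indicator {t<..} s \<partial>lborel)"
  have [measurable]: "I \<in> borel_measurable borel"
  proof -
    have "(\<lambda>t. \<integral>\<^sup>+s. (if t < s then ennreal ((s - t) powr (\<alpha> - 1) * s powr (- \<alpha>)) * H s else 0) \<partial>lborel) \<in> borel_measurable borel"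
      by measurable
    also have "(\<lambda>t. \<integral>\<^sup>+s. (if t < s then ennreal ((s - t) powr (\<alpha> - 1) * s powr (- \<alpha>)) * H s else 0) \<partial>lborel) = I"
      unfolding I_def by (intro ext nn_integral_cong) auto
    finally show ?thesis .
  qed
  define J where "J = (\<lambda>t s. (indicator {t<..} s * (s - t) powr (\<alpha> - 1)) *\<^sub>R W s)"
  have J [measurable]: "(\<lambda>(t, s). J t s) \<in> borel_measurable (borel \<Otimes>\<^sub>M borel)"
  proof -
    have "(\<lambda>(t, s). (if t < s then (s - t) powr (\<alpha> - 1) *\<^sub>R W s else 0)) \<in> borel_measurable (borel \<Otimes>\<^sub>M borel)"
      by measurable
    also have "(\<lambda>(t, s). (if t < s then (s - t) powr (\<alpha> - 1) *\<^sub>R W s else 0)) = (\<lambda>(t, s). J t s)"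
      unfolding J_def by auto
    finally show ?thesis .
  qed
  have IJ: "(\<integral>\<^sup>+s. norm (J t s) \<partial>lborel) = I t" if "t > 0" for t
    unfolding I_def
  proof (intro nn_integral_cong)
    fix s
    have "s powr (- \<alpha>) * s powr \<alpha> = 1" if "s > 0"
      using that by (simp add: powr_add[symmetric])
    then have "s > t \<Longrightarrow> (s - t) powr (\<alpha> - 1) * cmod (W s) = ((s - t) powr (\<alpha> - 1) * s powr (- \<alpha>)) * (s powr \<alpha> * cmod (W s))"
      using \<open>t > 0\<close> by (simp add: mult.assoc)
    then show "ennreal (norm (J t s)) = ennreal ((s - t) powr (\<alpha> - 1) * s powr (- \<alpha>)) * H s * indicator {t<..} s"
      unfolding H_def J_def by (auto simp: ennreal_mult[symmetric] split: split_indicator)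
  qed
  have "(\<integral>\<^sup>+t. (I t)\<^sup>2 * indicator {0<..} t \<partial>lborel)
      \<le> ennreal ((Beta \<alpha> (1/2))\<^sup>2) * (\<integral>\<^sup>+s. (H s)\<^sup>2 * indicator {0<..} s \<partial>lborel)"
    unfolding I_def by (rule weighted_Hardy_inequality[OF \<alpha>]) measurable
  also have "(\<integral>\<^sup>+s. (H s)\<^sup>2 * indicator {0<..} s \<partial>lborel)
      = (\<integral>\<^sup>+s. ennreal ((s powr \<alpha> * cmod (w s))\<^sup>2) * indicator {0<..} s \<partial>lborel)"
    by (intro nn_integral_cong) (auto simp: H_def W_def ennreal_power split: split_indicator)
  also have "ennreal ((Beta \<alpha> (1/2))\<^sup>2) * \<dots> < \<infinity>"
    using w by (simp add: L2_pos_weighted_iff ennreal_mult_less_top)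
  finally have fin: "(\<integral>\<^sup>+t. (I t)\<^sup>2 * indicator {0<..} t \<partial>lborel) < \<infinity>" .
  then have "AE t in lborel. (I t)\<^sup>2 * indicator {0<..} t \<noteq> \<infinity>"
    by (intro nn_integral_PInf_AE) auto
  then have conv: "AE t in lborel. 0 < t \<longrightarrow> weyl_converges \<alpha> w t"
  proof eventually_elim
    case (elim t)
    show ?case
    proof
      assume t: "0 < t"
      then have "I t < \<infinity>"
        using elim by (auto simp: power_less_top_ennreal top.not_eq_extremum)
      then have "integrable lborel (J t)"
        unfolding integrable_iff_bounded using IJ[OF t] by (auto simp: J_def)
      then show "weyl_converges \<alpha> w t"
        using t by (simp add: weyl_converges_iff J_def W_def)
    qed
  qed
  then show "is_weyl_derivative \<alpha> (weyl_integral \<alpha> w) w"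
    using w by (simp add: is_weyl_derivative_def)
  have eq: "weyl_integral \<alpha> w t = complex_of_real (1 / Gamma \<alpha>) * (LINT s|lborel. J t s)" if "t > 0" for t
    using that by (simp add: weyl_integral_eq J_def W_def)
  show "weyl_integral \<alpha> w \<in> L2_pos"
    unfolding L2_pos_iff
  proof
    have "(\<lambda>t. indicator {0<..} t *\<^sub>R (complex_of_real (1 / Gamma \<alpha>) * (LINT s|lborel. J t s))) \<in> borel_measurable borel"
      by measurable
    also have "(\<lambda>t. indicator {0<..} t *\<^sub>R (complex_of_real (1 / Gamma \<alpha>) * (LINT s|lborel. J t s)))
        = (\<lambda>t. indicator {0<..} t *\<^sub>R weyl_integral \<alpha> w t)"
      by (auto simp: eq split: split_indicator)
    finally show "(\<lambda>t. indicator {0<..} t *\<^sub>R weyl_integral \<alpha> w t) \<in> borel_measurable borel" .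
    \<comment> \<open>Stated for every \<open>t > 0\<close>: where the integral diverges the right
      side is infinite, so the default value of the left side is harmless.\<close>
    have "ennreal ((cmod (weyl_integral \<alpha> w t))\<^sup>2) \<le> ennreal ((1 / Gamma \<alpha>)\<^sup>2) * (I t)\<^sup>2" if t: "t > 0" for t
    proof (cases "I t = \<infinity>")
      case True
      then show ?thesis
        using \<alpha> by (simp add: ennreal_mult_top Gamma_real_pos less_imp_neq[OF Gamma_real_pos, symmetric] power2_eq_square)
    next
      case False
      then have "integrable lborel (J t)"
        unfolding integrable_iff_bounded using IJ[OF t] by (auto simp: J_def top.not_eq_extremum)
      then have "ennreal (cmod (LINT s|lborel. J t s)) \<le> I t"
        using integral_norm_bound_ennreal[of lborel "J t"] IJ[OF t] by simp
      then have "(ennreal (1 / Gamma \<alpha>) * ennreal (cmod (LINT s|lborel. J t s)))\<^sup>2 \<le> (ennreal (1 / Gamma \<alpha>) * I t)\<^sup>2"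
        by (intro power_mono mult_left_mono) auto
      moreover have "cmod (weyl_integral \<alpha> w t) = 1 / Gamma \<alpha> * cmod (LINT s|lborel. J t s)"
        using Gamma_real_pos[OF \<alpha>] unfolding eq[OF t] norm_mult norm_of_real by simp
      then have "ennreal ((cmod (weyl_integral \<alpha> w t))\<^sup>2) = (ennreal (1 / Gamma \<alpha>) * ennreal (cmod (LINT s|lborel. J t s)))\<^sup>2"
        using Gamma_real_pos[OF \<alpha>] by (simp add: ennreal_mult'[symmetric] ennreal_power)
      moreover have "(ennreal (1 / Gamma \<alpha>) * I t)\<^sup>2 = ennreal ((1 / Gamma \<alpha>)\<^sup>2) * (I t)\<^sup>2"
        using Gamma_real_pos[OF \<alpha>] by (simp add: power_mult_distrib ennreal_power)
      ultimately show ?thesis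
        by simp
    qed
    then have "(\<integral>\<^sup>+t. ennreal ((cmod (weyl_integral \<alpha> w t))\<^sup>2) * indicator {0<..} t \<partial>lborel)
       \<le> (\<integral>\<^sup>+t. ennreal ((1 / Gamma \<alpha>)\<^sup>2) * ((I t)\<^sup>2 * indicator {0<..} t) \<partial>lborel)"
      by (intro nn_integral_mono) (auto split: split_indicator)
    also have "\<dots> = ennreal ((1 / Gamma \<alpha>)\<^sup>2) * (\<integral>\<^sup>+t. (I t)\<^sup>2 * indicator {0<..} t \<partial>lborel)"
      by (rule nn_integral_cmult) measurable
    also have "\<dots> < \<infinity>"
      using fin by (simp add: ennreal_mult_less_top)
    finally show "(\<integral>\<^sup>+t. ennreal ((cmod (weyl_integral \<alpha> w t))\<^sup>2) * indicator {0<..} t \<partial>lborel) < \<infinity>" .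
  qed
qed

text \<open>A weighted form of Abel's inversion. The outer integration turns the hypothesis into
  vanishing tail integrals of \<open>(s - a) ^ N * G s\<close>, where \<open>G\<close> is a nowhere
  vanishing multiple of \<open>w\<close> on the positive axis.\<close>

lemma weyl_integral_eq_zero_imp_AE_zero:
  assumes \<alpha>: "\<alpha> > 0" and w: "w \<in> L2_pos_weighted \<alpha>"
    and zero: "AE t in lborel. 0 < t \<longrightarrow> weyl_integral \<alpha> w t = 0"
  shows "AE t in lborel. 0 < t \<longrightarrow> w t = 0"
proof -
  obtain N where N: "\<alpha> < real N"
    using reals_Archimedean2 by blast
  txt \<open>Integrating the hypothesis against \<open>(t - a) powr (\<beta> - 1) * t powr (- \<beta> - \<alpha>)\<close> turns the fractional
    kernel into an integer power; the factor \<open>t powr (- \<beta> - \<alpha>)\<close>, absent from the usual semigroup law,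
    is what makes the double integral converge at infinity.\<close>
  define \<beta> where "\<beta> = real (Suc N) - \<alpha>"
  have \<beta>: "\<beta> > 0" using N by (simp add: \<beta>_def)
  define W where "W = (\<lambda>s. indicator {0<..} s *\<^sub>R w s)"
  have W [measurable]: "W \<in> borel_measurable borel"
    using w by (simp add: W_def L2_pos_weighted_iff)
  \<comment> \<open>The factor \<open>s powr (- \<beta>)\<close> is the power of \<open>s\<close>
    left over by \<open>nn_integral_Beta_weighted\<close> with \<open>p = \<beta>\<close>,
    \<open>q = \<alpha>\<close>.\<close>
  define G where "G = (\<lambda>s. complex_of_real (s powr (- \<beta>)) * W s)"
  have [measurable]: "G \<in> borel_measurable borel"
    unfolding G_def by measurable
  have G: "set_integrable lborel {a<..} (\<lambda>s. complex_of_real (s ^ N) * G s)" if a: "a > 0" for a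
  proof -
    have h: "set_integrable lborel {a<..} (\<lambda>s. (cmod (complex_of_real (s powr \<alpha>) * W s))\<^sup>2)"
    proof -
      have "(\<integral>\<^sup>+s. ennreal ((cmod (complex_of_real (s powr \<alpha>) * W s))\<^sup>2) * indicator {a<..} s \<partial>lborel)
        \<le> (\<integral>\<^sup>+s. ennreal ((s powr \<alpha> * cmod (w s))\<^sup>2) * indicator {0<..} s \<partial>lborel)"
        using a by (intro nn_integral_mono) (auto simp: W_def norm_mult split: split_indicator)
      also have "\<dots> < \<infinity>"
        using w by (simp add: L2_pos_weighted_iff)
      finally show ?thesis
        by (intro set_integrable_nonnegI) (auto simp: set_borel_measurable_def)
    qed
    have i: "set_integrable lborel {a<..} (\<lambda>s. (cmod (complex_of_real (1 / s)))\<^sup>2)"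
    proof -
      have "(\<integral>\<^sup>+s. ennreal ((cmod (complex_of_real (1 / s)))\<^sup>2) * indicator {a<..} s \<partial>lborel)
        \<le> (\<integral>\<^sup>+s. ennreal ((s - a) powr (1 - 1) * s powr (- 1 - 1)) * indicator {a<..} s \<partial>lborel)"
        using a by (intro nn_integral_mono)
          (auto simp: norm_divide power_divide powr_minus_divide split: split_indicator)
      also have "\<dots> \<le> ennreal (Beta 1 1 * a powr (- 1))"
        using a by (intro nn_integral_Beta_tail) auto
      also have "\<dots> < \<infinity>" by simp
      finally show ?thesis
        by (intro set_integrable_nonnegI) (auto simp: set_borel_measurable_def)
    qed
    \<comment> \<open>Because \<open>N - \<beta> = \<alpha> - 1\<close>, the target function is
      \<open>1 / s\<close> times \<open>s powr \<alpha> * w s\<close>, a product of two functions in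
      L2 on the half-line beyond \<open>a\<close>.\<close>
    have "set_integrable lborel {a<..} (\<lambda>s. complex_of_real (1 / s) * (complex_of_real (s powr \<alpha>) * W s))"
      by (intro set_integrable_mult_of_squares h i) (auto simp: set_borel_measurable_def)
    also have "?this \<longleftrightarrow> ?thesis"
    proof (intro set_integrable_cong refl)
      fix s assume "s \<in> {a<..}"
      then have s: "s > 0" using a by simp
      have "- \<beta> = \<alpha> - real N - 1"
        by (simp add: \<beta>_def)
      then have "1 / s * s powr \<alpha> = s ^ N * s powr (- \<beta>)"
        using s by (simp add: powr_diff powr_realpow)
      then show "complex_of_real (1 / s) * (complex_of_real (s powr \<alpha>) * W s) = complex_of_real (s ^ N) * G s"
        unfolding G_def mult.assoc[symmetric] of_real_mult[symmetric] by (simp only:)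
    qed
    finally show ?thesis .
  qed
  have "AE s in lborel. 0 < s \<longrightarrow> G s = 0"
  proof (rule AE_zero_if_power_tail_integrals_zero[where n = N])
    have "(LINT s:{a<..}|lborel. complex_of_real ((s - a) ^ N) * G s) = 0" if a: "a > 0" for a
    proof -
      define C where "C = Beta \<beta> \<alpha> * a powr (- \<alpha>)"
      have C: "C > 0" using a \<alpha> \<beta> by (simp add: C_def Beta_def Gamma_real_pos)
      define \<kappa> where "\<kappa> = (\<lambda>t s. if a < t \<and> t < s then (t - a) powr (\<beta> - 1) * t powr (- \<beta> - \<alpha>) * (s - t) powr (\<alpha> - 1) else 0)"
      define \<Phi> where "\<Phi> = (\<lambda>s. if a < s then C * ((s - a) ^ N * s powr (- \<beta>)) else 0)"
      have m: "(\<lambda>(t, s). \<kappa> t s) \<in> borel_measurable (borel \<Otimes>\<^sub>M borel)"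
        unfolding \<kappa>_def by measurable
      have nonneg: "\<kappa> t s \<ge> 0" "\<Phi> s \<ge> 0" for t s
        using C by (auto simp: \<kappa>_def \<Phi>_def)
      have \<Phi>: "(\<integral>\<^sup>+t. ennreal (\<kappa> t s) \<partial>lborel) = ennreal (\<Phi> s)" for s
      proof (cases "a < s")
        case True
        have "(\<integral>\<^sup>+t. ennreal (\<kappa> t s) \<partial>lborel)
          = (\<integral>\<^sup>+t. ennreal ((t - a) powr (\<beta> - 1) * t powr (- \<beta> - \<alpha>) * (s - t) powr (\<alpha> - 1)) * indicator {a..s} t \<partial>lborel)"
        proof (rule nn_integral_cong_AE)
          show "AE t in lborel. ennreal (\<kappa> t s)
            = ennreal ((t - a) powr (\<beta> - 1) * t powr (- \<beta> - \<alpha>) * (s - t) powr (\<alpha> - 1)) * indicator {a..s} t"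
            using AE_lborel_singleton[of a] AE_lborel_singleton[of s]
            by eventually_elim (auto simp: \<kappa>_def split: split_indicator)
        qed
        also have "\<dots> = ennreal (Beta \<beta> \<alpha> * ((s - a) powr (\<beta> + \<alpha> - 1) * s powr (- \<beta>) * a powr (- \<alpha>)))"
          by (rule nn_integral_Beta_weighted[OF \<beta> \<alpha> a True])
        also have "\<beta> + \<alpha> - 1 = real N" by (simp add: \<beta>_def)
        finally show ?thesis
          using True by (simp add: \<Phi>_def C_def powr_realpow mult_ac)
      next
        case False
        then have "\<kappa> t s = 0" for t by (auto simp: \<kappa>_def)
        then show ?thesis using False by (simp add: \<Phi>_def)
      qed
      have \<Phi>W: "\<Phi> s *\<^sub>R W s = C *\<^sub>R (indicator {a<..} s *\<^sub>R (complex_of_real ((s - a) ^ N) * G s))" for s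
        by (auto simp: \<Phi>_def G_def scaleR_conv_of_real)
      have "set_integrable lborel {a<..} (\<lambda>s. complex_of_real ((s - a) ^ N) * G s)"
        by (rule set_integrable_weaken[OF _ G[OF a], of _ 1])
           (use a in \<open>auto simp: norm_mult norm_power intro!: mult_right_mono power_mono simp del: of_real_diff\<close>)
      then have int: "integrable lborel (\<lambda>s. \<Phi> s *\<^sub>R W s)"
        unfolding \<Phi>W set_integrable_def by (rule integrable_scaleR_right)
      have "(LINT s|lborel. \<Phi> s *\<^sub>R W s) = (LINT t|lborel. LINT s|lborel. \<kappa> t s *\<^sub>R W s)"
        by (rule kernel_Fubini(3)[OF m W nonneg \<Phi> int, symmetric])
      also have "\<dots> = 0"
      proof (rule integral_eq_zero_AE)
        show "AE t in lborel. (LINT s|lborel. \<kappa> t s *\<^sub>R W s) = 0"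
          using zero
        proof eventually_elim
          case (elim t)
          \<comment> \<open>For fixed \<open>t\<close> the kernel is \<open>d\<close> times the Weyl
            kernel at \<open>t\<close>. Either \<open>t \<le> a\<close> and \<open>d\<close> is 0,
            or the inner integral is \<open>Gamma \<alpha>\<close> times the Weyl integral at
            \<open>t\<close>, which vanishes by hypothesis.\<close>
          define d where "d = (if a < t then (t - a) powr (\<beta> - 1) * t powr (- \<beta> - \<alpha>) else 0)"
          have "(LINT s|lborel. \<kappa> t s *\<^sub>R W s) =
              (LINT s|lborel. d *\<^sub>R ((indicator {t<..} s * (s - t) powr (\<alpha> - 1)) *\<^sub>R W s))"
            by (intro Bochner_Integration.integral_cong) (auto simp: \<kappa>_def d_def)
          also have "\<dots> = d *\<^sub>R (LINT s|lborel. (indicator {t<..} s * (s - t) powr (\<alpha> - 1)) *\<^sub>R W s)"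
            by (rule integral_scaleR_right)
          finally have "(LINT s|lborel. \<kappa> t s *\<^sub>R W s) =
              d *\<^sub>R (LINT s|lborel. (indicator {t<..} s * (s - t) powr (\<alpha> - 1)) *\<^sub>R W s)" .
          moreover have "a < t \<Longrightarrow> (LINT s|lborel. (indicator {t<..} s * (s - t) powr (\<alpha> - 1)) *\<^sub>R W s) = 0"
            using elim a \<alpha> weyl_integral_eq[of t \<alpha> w] Gamma_real_pos[OF \<alpha>] by (simp add: W_def)
          ultimately show ?case by (auto simp: d_def)
        qed
      qed
      finally have "C *\<^sub>R (LINT s:{a<..}|lborel. complex_of_real ((s - a) ^ N) * G s) = 0"
        unfolding \<Phi>W set_lebesgue_integral_def integral_scaleR_right .
      then show ?thesis using C unfolding scaleR_eq_0_iff by simp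
    qed
    then show "AE a in lborel. 0 < a \<longrightarrow> (LINT s:{a<..}|lborel. complex_of_real ((s - a) ^ N) * G s) = 0"
      by simp
  qed (use G in auto)
  then show ?thesis
    by eventually_elim (auto simp: G_def W_def)
qed

text \<open>Injectivity applied to the difference. Splitting the integral of \<open>v - w\<close>
  needs both integrals to converge: with default values for divergent ones linearity would fail,
  which is why \<open>is_weyl_derivative\<close> includes convergence.\<close>

lemma is_weyl_derivative_unique:
  assumes "\<alpha> > 0" and v: "is_weyl_derivative \<alpha> f v" and w: "is_weyl_derivative \<alpha> f w"
  shows "AE t in lborel. 0 < t \<longrightarrow> v t = w t"
proof -
  have "AE t in lborel. 0 < t \<longrightarrow> weyl_integral \<alpha> (\<lambda>s. v s - w s) t = 0"
    using v w unfolding is_weyl_derivative_def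
  proof (elim conjE)
    assume "AE t in lborel. 0 < t \<longrightarrow> weyl_converges \<alpha> v t \<and> f t = weyl_integral \<alpha> v t"
      and "AE t in lborel. 0 < t \<longrightarrow> weyl_converges \<alpha> w t \<and> f t = weyl_integral \<alpha> w t"
    then show ?thesis
    proof eventually_elim
      case (elim t)
      show ?case
      proof
        assume "0 < t"
        then have "weyl_converges \<alpha> v t" "weyl_converges \<alpha> w t" "weyl_integral \<alpha> v t = weyl_integral \<alpha> w t"
          using elim by auto
        then show "weyl_integral \<alpha> (\<lambda>s. v s - w s) t = 0"
          unfolding weyl_converges_def weyl_integral_def
          by (simp add: right_diff_distrib set_integral_diff)
      qed
    qed
  qed
  moreover have "(\<lambda>s. v s - w s) \<in> L2_pos_weighted \<alpha>"
    using v w unfolding is_weyl_derivative_def by (elim conjE) (rule L2_pos_weighted_diff)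
  ultimately have "AE t in lborel. 0 < t \<longrightarrow> v t - w t = 0"
    by (rule weyl_integral_eq_zero_imp_AE_zero[OF \<open>\<alpha> > 0\<close>, rotated])
  then show ?thesis
    by simp
qed

section \<open>The reproducing kernel\<close>

lemma borel_measurable_g_kernel [measurable]: "g_kernel \<alpha> t \<in> borel_measurable borel"
  unfolding g_kernel_def pos_part_powr_def by measurable

text \<open>The square is a multiple of \<open>(r - t) powr (p - 1) * r powr (- p - 1)\<close> with
  \<open>p = 2 * \<alpha> - 1\<close>, and \<open>p > 0\<close>, the condition for a finite Beta
  integral, is exactly \<open>\<alpha> > 1/2\<close>.\<close>

lemma g_kernel_square_integrable:
  assumes \<alpha>: "\<alpha> > 1/2" and t: "t > 0"
  shows "set_integrable lborel {0<..} (\<lambda>r. (g_kernel \<alpha> t r)\<^sup>2)"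
proof (rule set_integrable_nonnegI)
  define c where "c = 1 / (Gamma \<alpha>)\<^sup>2"
  have eq: "ennreal ((g_kernel \<alpha> t r)\<^sup>2) * indicator {0<..} r =
      ennreal c * (ennreal ((r - t) powr ((2 * \<alpha> - 1) - 1) * r powr (- (2 * \<alpha> - 1) - 1)) * indicator {t<..} r)" for r
  proof (cases "t < r")
    case True
    have "((r - t) powr (\<alpha> - 1))\<^sup>2 = (r - t) powr ((2 * \<alpha> - 1) - 1)"
      by (simp add: power2_eq_square powr_add[symmetric] algebra_simps)
    moreover have "r powr (- (2 * \<alpha> - 1) - 1) = 1 / (r powr \<alpha>)\<^sup>2"
      by (simp add: power2_eq_square powr_add[symmetric] powr_minus_divide[symmetric])
    ultimately have "(g_kernel \<alpha> t r)\<^sup>2 = c * ((r - t) powr ((2 * \<alpha> - 1) - 1) * r powr (- (2 * \<alpha> - 1) - 1))"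
      using True by (simp add: g_kernel_def pos_part_powr_def c_def power_divide power_mult_distrib)
    then show ?thesis
      using True t by (simp add: c_def ennreal_mult'[symmetric])
  qed (auto simp: g_kernel_def pos_part_powr_def)
  have "(\<integral>\<^sup>+r. ennreal ((g_kernel \<alpha> t r)\<^sup>2) * indicator {0<..} r \<partial>lborel)
      = ennreal c * (\<integral>\<^sup>+r. ennreal ((r - t) powr ((2 * \<alpha> - 1) - 1) * r powr (- (2 * \<alpha> - 1) - 1)) * indicator {t<..} r \<partial>lborel)"
    unfolding eq by (rule nn_integral_cmult) measurable
  also have "\<dots> \<le> ennreal c * ennreal (Beta (2 * \<alpha> - 1) 1 * t powr (- 1))"
    using \<alpha> t by (intro mult_left_mono nn_integral_Beta_tail) auto
  also have "\<dots> < \<infinity>"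
    by (simp add: ennreal_mult_less_top)
  finally show "(\<integral>\<^sup>+r. ennreal ((g_kernel \<alpha> t r)\<^sup>2) * indicator {0<..} r \<partial>lborel) < \<infinity>" .
qed (auto simp: set_borel_measurable_def)

section \<open>Point values as pairings with \<open>g_kernel\<close>\<close>

lemma g_kernel_mult_weighted:
  assumes "\<alpha> > 0" "t > 0"
  shows "indicator {0<..} r *\<^sub>R (complex_of_real (g_kernel \<alpha> t r) * (complex_of_real (r powr \<alpha>) * z))
    = complex_of_real (1 / Gamma \<alpha>) * (indicator {t<..} r *\<^sub>R (complex_of_real ((r - t) powr (\<alpha> - 1)) * z))"
  using assms by (auto simp: g_kernel_def pos_part_powr_def split: split_indicator)

lemma weyl_converges_iff_g_kernel:
  assumes "\<alpha> > 0" "t > 0"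
  shows "weyl_converges \<alpha> w t \<longleftrightarrow>
    set_integrable lborel {0<..} (\<lambda>r. complex_of_real (g_kernel \<alpha> t r) * (complex_of_real (r powr \<alpha>) * w r))"
proof -
  have *: "integrable lborel (\<lambda>r. c * f r) \<longleftrightarrow> integrable lborel f" if "c \<noteq> 0"
    for c :: complex and f :: "real \<Rightarrow> complex"
    using integrable_mult_right[of "1 / c" lborel "\<lambda>r. c * f r"] integrable_mult_right[of c lborel f] that
    by auto
  then show ?thesis
    unfolding weyl_converges_def set_integrable_def g_kernel_mult_weighted[OF assms]
    using Gamma_real_pos[OF \<open>\<alpha> > 0\<close>] by (subst *) auto
qed

lemma weyl_integral_eq_g_kernel:
  assumes "\<alpha> > 0" "t > 0"
  shows "weyl_integral \<alpha> w t =
    (LINT r:{0<..}|lborel. complex_of_real (g_kernel \<alpha> t r) * (complex_of_real (r powr \<alpha>) * w r))"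
  unfolding weyl_integral_def set_lebesgue_integral_def g_kernel_mult_weighted[OF assms]
  by (rule integral_mult_right_zero[symmetric])

lemma weyl_converges_if_L2:
  assumes \<alpha>: "\<alpha> > 1/2" and t: "t > 0" and w: "w \<in> L2_pos_weighted \<alpha>"
  shows "weyl_converges \<alpha> w t"
proof -
  have "set_integrable lborel {0<..} (\<lambda>r. complex_of_real (g_kernel \<alpha> t r) * (complex_of_real (r powr \<alpha>) * w r))"
    using g_kernel_square_integrable[OF \<alpha> t] w
    by (intro set_integrable_mult_of_squares)
       (auto simp: set_borel_measurable_def L2_pos_weighted_def L2_pos_def)
  then show ?thesis
    using \<alpha> t by (simp add: weyl_converges_iff_g_kernel)
qed

lemma is_weyl_derivative_weyl_derivative:
  "f \<in> T2 \<alpha> \<Longrightarrow> is_weyl_derivative \<alpha> f (weyl_derivative \<alpha> f)"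
  using someI_ex[of "is_weyl_derivative \<alpha> f"] by (simp add: T2_def weyl_derivative_def)

text \<open>The way to get hold of \<open>weyl_derivative\<close>: for a function built as the Weyl
  integral of a prescribed \<open>w\<close>, the arbitrary choice returns \<open>w\<close> up to a
  null set.\<close>

lemma weyl_integral_in_T2:
  assumes "\<alpha> > 0" "w \<in> L2_pos_weighted \<alpha>"
  shows "weyl_integral \<alpha> w \<in> T2 \<alpha>"
    and "AE t in lborel. 0 < t \<longrightarrow> weyl_derivative \<alpha> (weyl_integral \<alpha> w) t = w t"
proof -
  note w = weyl_integral_is_weyl_derivative[OF assms]
  show T2: "weyl_integral \<alpha> w \<in> T2 \<alpha>"
    using w by (auto simp: T2_def)
  show "AE t in lborel. 0 < t \<longrightarrow> weyl_derivative \<alpha> (weyl_integral \<alpha> w) t = w t"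
    by (rule is_weyl_derivative_unique[OF assms(1) is_weyl_derivative_weyl_derivative[OF T2] w(2)])
qed

lemma weyl_derivative_measurable:
  assumes "f \<in> T2 \<alpha>"
  shows "(\<lambda>r. indicator {0<..} r *\<^sub>R weyl_derivative \<alpha> f r) \<in> borel_measurable borel"
  using is_weyl_derivative_weyl_derivative[OF assms]
  by (simp add: is_weyl_derivative_def L2_pos_weighted_iff)

lemma set_lebesgue_integral_cong_AE_positive:
  fixes F G :: "real \<Rightarrow> complex"
  assumes "(\<lambda>r. indicator {0<..} r *\<^sub>R F r) \<in> borel_measurable borel"
    and "(\<lambda>r. indicator {0<..} r *\<^sub>R G r) \<in> borel_measurable borel"
    and "AE r in lborel. 0 < r \<longrightarrow> F r = G r"
  shows "(LINT r:{0<..}|lborel. F r) = (LINT r:{0<..}|lborel. G r)"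
  unfolding set_lebesgue_integral_def using assms
  by (intro integral_cong_AE) (auto elim!: eventually_mono split: split_indicator)

text \<open>The kernel function at \<open>t\<close> is the Weyl integral of this function.\<close>

definition kernel_derivative :: "real \<Rightarrow> real \<Rightarrow> real \<Rightarrow> complex" where
  "kernel_derivative \<alpha> t r = complex_of_real (g_kernel \<alpha> t r * r powr (- \<alpha>))"

lemma borel_measurable_kernel_derivative [measurable]: "kernel_derivative \<alpha> t \<in> borel_measurable borel"
  unfolding kernel_derivative_def by measurable

lemma weight_kernel_derivative:
  "r > 0 \<Longrightarrow> complex_of_real (r powr \<alpha>) * kernel_derivative \<alpha> t r = complex_of_real (g_kernel \<alpha> t r)"
  by (simp add: kernel_derivative_def powr_minus_divide)

lemma kernel_derivative_in_L2_pos_weighted: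
  assumes "\<alpha> > 1/2" "t > 0"
  shows "kernel_derivative \<alpha> t \<in> L2_pos_weighted \<alpha>"
proof -
  have "set_integrable lborel {0<..} (\<lambda>r. (cmod (complex_of_real (r powr \<alpha>) * kernel_derivative \<alpha> t r))\<^sup>2)
     \<longleftrightarrow> set_integrable lborel {0<..} (\<lambda>r. (g_kernel \<alpha> t r)\<^sup>2)"
    by (intro set_integrable_cong refl) (simp add: weight_kernel_derivative)
  then show ?thesis
    using g_kernel_square_integrable[OF assms]
    by (simp add: L2_pos_weighted_def L2_pos_def set_borel_measurable_def)
qed

text \<open>Up to null sets the derivative of the kernel function is
  \<open>g_kernel \<alpha> t r * r powr (- \<alpha>)\<close>. It is real, so conjugation does
  nothing, and the pairing becomes the integral expression for the value of \<open>f\<close> at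
  \<open>t\<close>.\<close>

lemma represents_evaluation_kernel:
  assumes \<alpha>: "\<alpha> > 1/2" and t: "t > 0"
  shows "represents_evaluation \<alpha> t (weyl_integral \<alpha> (kernel_derivative \<alpha> t))"
proof -
  define k where "k = weyl_integral \<alpha> (kernel_derivative \<alpha> t)"
  have \<alpha>0: "\<alpha> > 0" using \<alpha> by simp
  note kd = kernel_derivative_in_L2_pos_weighted[OF assms]
  note k = weyl_integral_in_T2[OF \<alpha>0 kd, folded k_def]
  have "T2_has_value \<alpha> f t \<and> T2_inner \<alpha> f k = T2_value \<alpha> f t" if f: "f \<in> T2 \<alpha>" for f
  proof
    define w where "w = weyl_derivative \<alpha> f"
    have w: "w \<in> L2_pos_weighted \<alpha>"
      using is_weyl_derivative_weyl_derivative[OF f] by (simp add: is_weyl_derivative_def w_def)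
    then show "T2_has_value \<alpha> f t"
      unfolding T2_has_value_def w_def[symmetric] by (rule weyl_converges_if_L2[OF assms])
    define W where "W = (\<lambda>r. indicator {0<..} r *\<^sub>R w r)"
    define V where "V = (\<lambda>r. indicator {0<..} r *\<^sub>R weyl_derivative \<alpha> k r)"
    have [measurable]: "W \<in> borel_measurable borel" "V \<in> borel_measurable borel"
      using weyl_derivative_measurable f k(1) by (auto simp: W_def V_def w_def)
    have [measurable]: "cnj \<in> borel_measurable borel"
      by (intro borel_measurable_continuous_onI continuous_intros)
    have "(\<lambda>r. W r * cnj (V r) * complex_of_real (r powr (2 * \<alpha>))) \<in> borel_measurable borel"
      by measurable
    also have "(\<lambda>r. W r * cnj (V r) * complex_of_real (r powr (2 * \<alpha>)))
        = (\<lambda>r. indicator {0<..} r *\<^sub>R (w r * cnj (weyl_derivative \<alpha> k r) * complex_of_real (r powr (2 * \<alpha>))))"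
      by (auto simp: W_def V_def split: split_indicator)
    finally have meas: "\<dots> \<in> borel_measurable borel" .
    have "(\<lambda>r. complex_of_real (g_kernel \<alpha> t r) * (complex_of_real (r powr \<alpha>) * W r)) \<in> borel_measurable borel"
      by measurable
    also have "(\<lambda>r. complex_of_real (g_kernel \<alpha> t r) * (complex_of_real (r powr \<alpha>) * W r))
        = (\<lambda>r. indicator {0<..} r *\<^sub>R (complex_of_real (g_kernel \<alpha> t r) * (complex_of_real (r powr \<alpha>) * w r)))"
      by (auto simp: W_def split: split_indicator)
    finally have meas': "\<dots> \<in> borel_measurable borel" .
    have "T2_inner \<alpha> f k = (LINT r:{0<..}|lborel. complex_of_real (g_kernel \<alpha> t r) * (complex_of_real (r powr \<alpha>) * w r))"
      unfolding T2_inner_def w_def[symmetric]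
    proof (rule set_lebesgue_integral_cong_AE_positive[OF meas meas'])
      show "AE r in lborel. 0 < r \<longrightarrow> w r * cnj (weyl_derivative \<alpha> k r) * complex_of_real (r powr (2 * \<alpha>))
          = complex_of_real (g_kernel \<alpha> t r) * (complex_of_real (r powr \<alpha>) * w r)"
        using k(2)
      proof eventually_elim
        case (elim r)
        \<comment> \<open>Half of the weight \<open>r powr (2 * \<alpha>)\<close> cancels the decay
          built into \<open>kernel_derivative\<close>; the other half stays with
          \<open>w\<close>.\<close>
        have "g_kernel \<alpha> t r * r powr (- \<alpha>) * r powr (2 * \<alpha>) = g_kernel \<alpha> t r * r powr \<alpha>"
          by (simp add: powr_add[symmetric] mult.assoc)
        then have "complex_of_real (g_kernel \<alpha> t r * r powr (- \<alpha>)) * complex_of_real (r powr (2 * \<alpha>))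
            = complex_of_real (g_kernel \<alpha> t r) * complex_of_real (r powr \<alpha>)"
          unfolding of_real_mult[symmetric] by (simp only:)
        then show ?case
          using elim by (simp add: kernel_derivative_def mult_ac del: of_real_mult)
      qed
    qed
    then show "T2_inner \<alpha> f k = T2_value \<alpha> f t"
      by (simp add: T2_value_def weyl_integral_eq_g_kernel[OF \<alpha>0 t] w_def)
  qed
  then show ?thesis
    using k(1) by (simp add: represents_evaluation_def k_def)
qed

lemma T2_value_kernel:
  assumes \<alpha>: "\<alpha> > 1/2" and s: "s > 0" and t: "t > 0"
  shows "T2_value \<alpha> (weyl_integral \<alpha> (kernel_derivative \<alpha> s)) t
    = complex_of_real (LINT r:{0<..}|lborel. g_kernel \<alpha> s r * g_kernel \<alpha> t r)"
proof -
  define k where "k = weyl_integral \<alpha> (kernel_derivative \<alpha> s)"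
  have \<alpha>0: "\<alpha> > 0" using \<alpha> by simp
  note k = weyl_integral_in_T2[OF \<alpha>0 kernel_derivative_in_L2_pos_weighted[OF \<alpha> s], folded k_def]
  have [measurable]: "(\<lambda>r. indicator {0<..} r *\<^sub>R weyl_derivative \<alpha> k r) \<in> borel_measurable borel"
    by (rule weyl_derivative_measurable[OF k(1)])
  have "(\<lambda>r. complex_of_real (g_kernel \<alpha> t r) * (complex_of_real (r powr \<alpha>) * (indicator {0<..} r *\<^sub>R weyl_derivative \<alpha> k r))) \<in> borel_measurable borel"
    by measurable
  then have "T2_value \<alpha> k t = (LINT r:{0<..}|lborel. complex_of_real (g_kernel \<alpha> s r * g_kernel \<alpha> t r))"
    unfolding T2_value_def weyl_integral_eq_g_kernel[OF \<alpha>0 t]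
  proof (intro set_lebesgue_integral_cong_AE_positive)
    show "AE r in lborel. 0 < r \<longrightarrow> complex_of_real (g_kernel \<alpha> t r) * (complex_of_real (r powr \<alpha>) * weyl_derivative \<alpha> k r)
        = complex_of_real (g_kernel \<alpha> s r * g_kernel \<alpha> t r)"
      using k(2) by eventually_elim (simp add: weight_kernel_derivative)
  qed (simp_all add: mult_ac)
  then show ?thesis
    by (simp only: k_def set_integral_complex_of_real)
qed

text \<open>Holds without integrability, since conjugation commutes with the integral even at its
  default value 0.\<close>

lemma T2_inner_cnj: "T2_inner \<alpha> f g = cnj (T2_inner \<alpha> g f)"
  unfolding T2_inner_def set_lebesgue_integral_def Bochner_Integration.integral_cnj[symmetric]
  by (intro Bochner_Integration.integral_cong) (auto simp: scaleR_conv_of_real mult_ac)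

text \<open>The definition evaluates an arbitrary representer \<open>K\<close> for \<open>t\<close>
  at the point \<open>s\<close>. Pairing \<open>K\<close> with the explicit representer
  \<open>k\<close> for \<open>s\<close> gives \<open>K\<close> at \<open>s\<close> in one order and
  \<open>k\<close> at \<open>t\<close> in the other, so Hermitian symmetry computes the value
  without comparing \<open>K\<close> to the explicit representer for \<open>t\<close>.\<close>

lemma T2_reproducing_kernel_eq:
  assumes \<alpha>: "\<alpha> > 1/2" and s: "s > 0" and t: "t > 0"
  shows "T2_reproducing_kernel \<alpha> s t
    = complex_of_real (LINT r:{0<..}|lborel. g_kernel \<alpha> s r * g_kernel \<alpha> t r)"
proof -
  define K where "K = (SOME k. represents_evaluation \<alpha> t k)"
  define k where "k = weyl_integral \<alpha> (kernel_derivative \<alpha> s)"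
  have K: "represents_evaluation \<alpha> t K"
    unfolding K_def using represents_evaluation_kernel[OF \<alpha> t] by (rule someI[where P = "represents_evaluation \<alpha> t"])
  have k: "represents_evaluation \<alpha> s k"
    unfolding k_def by (rule represents_evaluation_kernel[OF \<alpha> s])
  have "T2_reproducing_kernel \<alpha> s t = T2_value \<alpha> K s"
    by (simp add: T2_reproducing_kernel_def K_def)
  also have "\<dots> = T2_inner \<alpha> K k"
    using K k by (simp add: represents_evaluation_def)
  also have "\<dots> = cnj (T2_inner \<alpha> k K)"
    by (rule T2_inner_cnj)
  also have "T2_inner \<alpha> k K = T2_value \<alpha> k t"
    using K k by (simp add: represents_evaluation_def)
  finally show ?thesis
    unfolding k_def T2_value_kernel[OF assms] by simp
qed

section \<open>Failure of point evaluation for small orders\<close>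

text \<open>The antiderivative \<open>1 / (1 - ln (r - 1))\<close> rises from 0 at the left end to 1
  at \<open>r = 2\<close>.\<close>

lemma nn_integral_inverse_log_squared:
  "(\<integral>\<^sup>+r. ennreal (1 / ((r - 1) * (1 - ln (r - 1))\<^sup>2)) * indicator {1<..<2} r \<partial>lborel) \<le> 1"
proof -
  define f where "f = (\<lambda>r::real. 1 / ((r - 1) * (1 - ln (r - 1))\<^sup>2))"
  define F where "F = (\<lambda>N r. ennreal (f r) * indicator {1 + 1 / real (Suc N)..2} r)"
  have "(\<integral>\<^sup>+r. F N r \<partial>lborel) \<le> 1" for N
  proof -
    define a where "a = 1 + 1 / real (Suc N)"
    have a: "1 < a" "a \<le> 2" by (auto simp: a_def)
    have ln: "ln (r - 1) \<le> 0" if "r \<in> {a..2}" for r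
      using that a by (auto simp: ln_le_zero_iff)
    have "(\<integral>\<^sup>+r. F N r \<partial>lborel) = ennreal (1 / (1 - ln (2 - 1)) - 1 / (1 - ln (a - 1)))"
      unfolding F_def a_def[symmetric]
    proof (rule nn_integral_FTC_Icc)
      fix r assume r: "r \<in> {a..2}"
      then have "r > 1"
        using a by simp
      have "ln (r - 1) \<le> 0"
        using r by (rule ln)
      then have "1 - ln (r - 1) > 0"
        by linarith
      with \<open>r > 1\<close> show "((\<lambda>r. 1 / (1 - ln (r - 1))) has_real_derivative f r) (at r)"
        unfolding f_def by (auto intro!: derivative_eq_intros simp: power2_eq_square)
      show "0 \<le> f r"
        using \<open>r > 1\<close> by (simp add: f_def)
    qed (use a in \<open>auto simp: f_def\<close>)
    also have "\<dots> \<le> 1"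
      using ln[of a] a by (simp del: ln_le_zero_iff)
    finally show ?thesis .
  qed
  then have bound: "(SUP N. \<integral>\<^sup>+r. F N r \<partial>lborel) \<le> 1"
    by (rule SUP_least)
  have "(\<integral>\<^sup>+r. ennreal (f r) * indicator {1<..<2} r \<partial>lborel) \<le> (\<integral>\<^sup>+r. (SUP N. F N r) \<partial>lborel)"
  proof (intro nn_integral_mono)
    fix r :: real
    show "ennreal (f r) * indicator {1<..<2} r \<le> (SUP N. F N r)"
    proof (cases "r \<in> {1<..<2}")
      case True
      then obtain N where "1 / real (Suc N) < r - 1"
        using nat_approx_posE[of "r - 1"] by auto
      then have "ennreal (f r) * indicator {1<..<2} r \<le> F N r"
        using True by (simp add: F_def)
      then show ?thesis by (meson SUP_upper2 UNIV_I)
    qed simp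
  qed
  also have "\<dots> = (SUP N. \<integral>\<^sup>+r. F N r \<partial>lborel)"
  proof (intro nn_integral_monotone_convergence_SUP)
    show "incseq F"
    proof (rule incseq_SucI, rule le_funI)
      fix N r
      have "1 / real (Suc (Suc N)) \<le> 1 / real (Suc N)"
        by (intro divide_left_mono) auto
      then show "F N r \<le> F (Suc N) r"
        unfolding F_def by (intro mult_left_mono) (auto split: split_indicator)
    qed
  qed (auto simp: F_def f_def)
  finally show ?thesis
    using bound by (auto simp: f_def)
qed

text \<open>The antiderivative \<open>- ln (1 - ln (r - 1))\<close> tends to minus infinity at the
  left end.\<close>

lemma nn_integral_inverse_log:
  "(\<integral>\<^sup>+r. ennreal (1 / ((r - 1) * (1 - ln (r - 1)))) * indicator {1<..<2} r \<partial>lborel) = \<infinity>"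
proof -
  define f where "f = (\<lambda>r::real. 1 / ((r - 1) * (1 - ln (r - 1))))"
  have unbounded: "ennreal x \<le> (\<integral>\<^sup>+r. ennreal (f r) * indicator {1<..<2} r \<partial>lborel)" if x: "x > 0" for x
  proof -
    \<comment> \<open>Solves \<open>1 - ln (a - 1) = exp x\<close>, so that the integral from
      \<open>a\<close> to 2 is exactly \<open>x\<close>.\<close>
    define a where "a = 1 + exp (1 - exp x)"
    have a: "1 < a" "a \<le> 2" using x by (auto simp: a_def)
    have ln: "ln (r - 1) \<le> 0" if "r \<in> {a..2}" for r
      using that a by (auto simp: ln_le_zero_iff)
    have "ennreal x = ennreal (- ln (1 - ln (2 - 1)) - (- ln (1 - ln (a - 1))))"
      by (simp add: a_def)
    also have "\<dots> = (\<integral>\<^sup>+r. ennreal (f r) * indicator {a..2} r \<partial>lborel)"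
    proof (rule nn_integral_FTC_Icc[symmetric])
      fix r assume r: "r \<in> {a..2}"
      then have "r > 1"
        using a by simp
      have "ln (r - 1) \<le> 0"
        using r by (rule ln)
      then have "1 - ln (r - 1) > 0"
        by linarith
      with \<open>r > 1\<close> show "((\<lambda>r. - ln (1 - ln (r - 1))) has_real_derivative f r) (at r)"
        unfolding f_def by (auto intro!: derivative_eq_intros)
      show "0 \<le> f r"
        using \<open>r > 1\<close> \<open>1 - ln (r - 1) > 0\<close> by (simp add: f_def)
    qed (use a in \<open>auto simp: f_def\<close>)
    also have "\<dots> \<le> (\<integral>\<^sup>+r. ennreal (f r) * indicator {1<..<2} r \<partial>lborel)"
    proof (rule nn_integral_mono_AE)
      show "AE r in lborel. ennreal (f r) * indicator {a..2} r \<le> ennreal (f r) * indicator {1<..<2} r"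
        using AE_lborel_singleton[of 2] by eventually_elim (use a in \<open>auto split: split_indicator\<close>)
    qed
    finally show ?thesis .
  qed
  have "(\<integral>\<^sup>+r. ennreal (f r) * indicator {1<..<2} r \<partial>lborel) = \<infinity>"
  proof (cases "\<integral>\<^sup>+r. ennreal (f r) * indicator {1<..<2} r \<partial>lborel")
    case (real c)
    have "ennreal (c + 1) \<le> ennreal c"
      unfolding real(2)[symmetric] using real(1) by (intro unbounded) simp
    then have "c + 1 \<le> c"
      using real(1) by (simp only: ennreal_le_iff)
    then show ?thesis by simp
  qed simp
  then show ?thesis
    by (simp add: f_def)
qed

text \<open>For \<open>\<alpha> = 1/2\<close> the singularity of \<open>g_kernel\<close> only just
  fails to be square integrable, so no pure power can serve as \<open>h\<close>: the logarithm makes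
  its square integrable and its product with \<open>g_kernel\<close> not. Smaller
  \<open>\<alpha>\<close> only sharpens the singularity, so the same \<open>h\<close> works
  throughout.\<close>

lemma not_T2_is_RKHS:
  assumes \<alpha>: "\<alpha> > 0" "\<alpha> \<le> 1/2"
  shows "\<not> T2_is_RKHS \<alpha>"
proof
  assume "T2_is_RKHS \<alpha>"
  then obtain k where k: "represents_evaluation \<alpha> 1 k"
    unfolding T2_is_RKHS_def by (meson zero_less_one)
  txt \<open>This \<open>h\<close> is square integrable, but its product with \<open>g_kernel \<alpha> 1\<close> is at least a multiple of
    \<open>1 / ((r - 1) * (1 - ln (r - 1)))\<close> near \<open>1\<close>.\<close>
  define h where "h = (\<lambda>r::real. if 1 < r \<and> r < 2 then (r - 1) powr (- (1/2)) / (1 - ln (r - 1)) else 0)"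
  have [measurable]: "h \<in> borel_measurable borel"
    unfolding h_def by measurable
  define w where "w = (\<lambda>r. complex_of_real (h r * r powr (- \<alpha>)))"
  have [measurable]: "w \<in> borel_measurable borel"
    unfolding w_def by measurable
  have weight: "complex_of_real (r powr \<alpha>) * w r = complex_of_real (h r)" for r
    by (cases "r = 0") (auto simp: w_def h_def powr_minus_divide)
  have w: "w \<in> L2_pos_weighted \<alpha>"
  proof -
    have "ennreal ((r powr \<alpha> * cmod (w r))\<^sup>2) = ennreal (1 / ((r - 1) * (1 - ln (r - 1))\<^sup>2)) * indicator {1<..<2} r" for r
    proof -
      have "(r powr \<alpha> * cmod (w r))\<^sup>2 = (cmod (complex_of_real (r powr \<alpha>) * w r))\<^sup>2"
        by (simp add: norm_mult)
      also have "\<dots> = (h r)\<^sup>2"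
        by (simp add: weight)
      finally show ?thesis
        by (auto simp: h_def power_divide power_mult_distrib powr_minus_divide powr_half_sqrt split: split_indicator)
    qed
    then have "(\<integral>\<^sup>+r. ennreal ((r powr \<alpha> * cmod (w r))\<^sup>2) * indicator {0<..} r \<partial>lborel)
        = (\<integral>\<^sup>+r. ennreal (1 / ((r - 1) * (1 - ln (r - 1))\<^sup>2)) * indicator {1<..<2} r \<partial>lborel)"
      by (intro nn_integral_cong) (auto split: split_indicator)
    also have "\<dots> < \<infinity>"
      using nn_integral_inverse_log_squared by (rule le_less_trans) simp
    finally show ?thesis
      by (simp add: L2_pos_weighted_iff)
  qed
  define f where "f = weyl_integral \<alpha> w"
  note f = weyl_integral_in_T2[OF \<alpha>(1) w, folded f_def]
  have [measurable]: "(\<lambda>r. indicator {0<..} r *\<^sub>R weyl_derivative \<alpha> f r) \<in> borel_measurable borel"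
    by (rule weyl_derivative_measurable[OF f(1)])
  \<comment> \<open>This speaks of the chosen derivative of \<open>f\<close>; that it equals
    \<open>w\<close> almost everywhere is what carries the divergence over from
    \<open>h\<close>.\<close>
  have "T2_has_value \<alpha> f 1"
    using k f(1) by (simp add: represents_evaluation_def)
  then have "integrable lborel (\<lambda>r. indicator {0<..} r *\<^sub>R (complex_of_real (g_kernel \<alpha> 1 r) * (complex_of_real (r powr \<alpha>) * weyl_derivative \<alpha> f r)))"
    unfolding T2_has_value_def using \<alpha>(1) by (simp add: weyl_converges_iff_g_kernel set_integrable_def)
  then have "(\<integral>\<^sup>+r. ennreal (cmod (indicator {0<..} r *\<^sub>R (complex_of_real (g_kernel \<alpha> 1 r) * (complex_of_real (r powr \<alpha>) * weyl_derivative \<alpha> f r)))) \<partial>lborel) < \<infinity>"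
    by (simp add: integrable_iff_bounded)
  also have "(\<integral>\<^sup>+r. ennreal (cmod (indicator {0<..} r *\<^sub>R (complex_of_real (g_kernel \<alpha> 1 r) * (complex_of_real (r powr \<alpha>) * weyl_derivative \<alpha> f r)))) \<partial>lborel)
    = (\<integral>\<^sup>+r. ennreal (g_kernel \<alpha> 1 r * h r) \<partial>lborel)"
  proof (rule nn_integral_cong_AE)
    show "AE r in lborel. ennreal (cmod (indicator {0<..} r *\<^sub>R (complex_of_real (g_kernel \<alpha> 1 r) * (complex_of_real (r powr \<alpha>) * weyl_derivative \<alpha> f r))))
        = ennreal (g_kernel \<alpha> 1 r * h r)"
      using f(2)
    proof eventually_elim
      case (elim r)
      have "g_kernel \<alpha> 1 r \<ge> 0"
        using \<alpha> by (simp add: g_kernel_def pos_part_powr_def Gamma_real_nonneg)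
      moreover have "h r \<ge> 0"
      proof (cases "1 < r \<and> r < 2")
        case True
        then have "ln (r - 1) \<le> 0"
          by simp
        then have "0 \<le> 1 - ln (r - 1)"
          by linarith
        then show ?thesis
          by (simp add: h_def del: diff_ge_0_iff_ge)
      qed (auto simp: h_def)
      moreover have "complex_of_real (r powr \<alpha>) * weyl_derivative \<alpha> f r = complex_of_real (h r)" if "r > 0"
        using elim that weight by simp
      ultimately show ?case
        by (cases "r > 0") (simp_all add: norm_mult del: mult_eq_0_iff, simp add: h_def)
    qed
  qed
  finally have fin: "(\<integral>\<^sup>+r. ennreal (g_kernel \<alpha> 1 r * h r) \<partial>lborel) < \<infinity>" .
  \<comment> \<open>The smallest value of \<open>1 / (r powr \<alpha> * Gamma \<alpha>)\<close> up
    to \<open>r = 2\<close>: away from the singularity \<open>g_kernel\<close> is bounded below by a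
    constant.\<close>
  define c where "c = 1 / (2 powr \<alpha> * Gamma \<alpha>)"
  have c: "c > 0"
    using \<alpha> by (simp add: c_def Gamma_real_pos)
  have "ennreal c * (ennreal (1 / ((r - 1) * (1 - ln (r - 1)))) * indicator {1<..<2} r) \<le> ennreal (g_kernel \<alpha> 1 r * h r)" for r
  proof (cases "1 < r \<and> r < 2")
    case True
    have "ln (r - 1) \<le> 0" using True by simp
    have "c / (r - 1) \<le> (r - 1) powr (\<alpha> - 1) / (r powr \<alpha> * Gamma \<alpha>) * (r - 1) powr (- (1/2))"
    proof -
      \<comment> \<open>The base lies below 1 and \<open>\<alpha> - 3/2 \<le> -1\<close>; this is
        where \<open>\<alpha> \<le> 1/2\<close> enters.\<close>
      have "(r - 1) powr (- 1) \<le> (r - 1) powr (\<alpha> - 1 - 1/2)"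
        using \<alpha> True by (intro powr_mono') auto
      also have "\<dots> = (r - 1) powr (\<alpha> - 1) * (r - 1) powr (- (1/2))"
        by (simp add: powr_add[symmetric])
      finally have 1: "1 / (r - 1) \<le> (r - 1) powr (\<alpha> - 1) * (r - 1) powr (- (1/2))"
        using True by (simp add: powr_minus_divide)
      have 2: "c \<le> 1 / (r powr \<alpha> * Gamma \<alpha>)"
        unfolding c_def using True \<alpha> Gamma_real_pos[OF \<alpha>(1)]
        by (intro divide_left_mono mult_right_mono powr_mono2) auto
      have "c * (1 / (r - 1)) \<le> 1 / (r powr \<alpha> * Gamma \<alpha>) * ((r - 1) powr (\<alpha> - 1) * (r - 1) powr (- (1/2)))"
        using c True by (intro mult_mono[OF 2 1] order_trans[OF less_imp_le[OF c] 2]) auto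
      then show ?thesis by (simp add: mult_ac)
    qed
    then have "c / (r - 1) / (1 - ln (r - 1)) \<le> (r - 1) powr (\<alpha> - 1) / (r powr \<alpha> * Gamma \<alpha>) * (r - 1) powr (- (1/2)) / (1 - ln (r - 1))"
      using \<open>ln (r - 1) \<le> 0\<close> by (intro divide_right_mono) auto
    then have "c * (1 / ((r - 1) * (1 - ln (r - 1)))) \<le> g_kernel \<alpha> 1 r * h r"
      using True by (simp add: g_kernel_def pos_part_powr_def h_def)
    then show ?thesis
      using True c by (simp add: ennreal_mult'[symmetric] ennreal_leI)
  qed auto
  then have "(\<integral>\<^sup>+r. ennreal c * (ennreal (1 / ((r - 1) * (1 - ln (r - 1)))) * indicator {1<..<2} r) \<partial>lborel)
      \<le> (\<integral>\<^sup>+r. ennreal (g_kernel \<alpha> 1 r * h r) \<partial>lborel)"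
    by (rule nn_integral_mono)
  then have "(\<integral>\<^sup>+r. ennreal c * (ennreal (1 / ((r - 1) * (1 - ln (r - 1)))) * indicator {1<..<2} r) \<partial>lborel) < \<infinity>"
    using fin by (rule le_less_trans)
  moreover have "(\<integral>\<^sup>+r. ennreal c * (ennreal (1 / ((r - 1) * (1 - ln (r - 1)))) * indicator {1<..<2} r) \<partial>lborel)
    = ennreal c * (\<integral>\<^sup>+r. ennreal (1 / ((r - 1) * (1 - ln (r - 1)))) * indicator {1<..<2} r \<partial>lborel)"
    by (rule nn_integral_cmult) measurable
  ultimately show False
    using c by (simp add: nn_integral_inverse_log ennreal_mult_top)
qed

theorem proposition4p1:
  fixes \<alpha> :: real
  assumes "\<alpha> > 0"
  shows "(T2_is_RKHS \<alpha> \<longleftrightarrow> \<alpha> > 1 / 2) \<and>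
    (T2_is_RKHS \<alpha> \<longrightarrow>
      (\<forall>s>0. \<forall>t>0.
         set_integrable lborel {0<..} (\<lambda>r. g_kernel \<alpha> s r * g_kernel \<alpha> t r) \<and>
         T2_reproducing_kernel \<alpha> s t =
           complex_of_real (LINT r:{0<..}|lborel. g_kernel \<alpha> s r * g_kernel \<alpha> t r)))"
proof -
  have iff: "T2_is_RKHS \<alpha> \<longleftrightarrow> \<alpha> > 1 / 2"
    using not_T2_is_RKHS[OF assms] represents_evaluation_kernel[of \<alpha>]
    by (auto simp: T2_is_RKHS_def not_less[symmetric])
  \<comment> \<open>Guarantees that the integral in the kernel formula is a genuine one and not the
    default value 0.\<close>
  have "set_integrable lborel {0<..} (\<lambda>r. g_kernel \<alpha> s r * g_kernel \<alpha> t r)"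
    if "\<alpha> > 1 / 2" "s > 0" "t > 0" for s t
    using that g_kernel_square_integrable
    by (intro set_integrable_mult_of_squares) (auto simp: set_borel_measurable_def)
  then show ?thesis
    using iff T2_reproducing_kernel_eq by blast
qed

end
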